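(* Let $A$ be a linear, closed, densely defined, unbounded operator in a Hilbert space $H$ which is not boundedly invertible. Put $T:=A^*A$, $Q:=AA^*$, and, for a constant $\alpha>0$, $T_\alpha:=T+\alpha I$, $Q_\alpha:=Q+\alpha I$. (i) For any $f\in H$ and any $\alpha>0$, the functional $F(u)=\|Au-f\|^2+\alpha\|u\|^2$, $u\in D(A)$, has a unique global minimizer $u_\alpha=A^*Q_\alpha^{-1}f$, and $$A^*Q_\alpha^{-1}f=\overline{T_\alpha^{-1}A^*}\,f,$$ where $\overline{T_\alpha^{-1}A^*}$ is the closure of the operator $T_\alpha^{-1}A^*$ defined on $D(A^* )$. (ii) If $f\in R(A)$, then $$\lim_{\alpha\to 0}\|u_\alpha-y\|=0,$$ where $u_\alpha$ is the unique global minimizer of $F$ and $y$ is the minimal-norm solution of $Au=f$. (iii) Let $f\in R(A)$, $f\neq 0$, let $y$ be the minimal-norm solution of $Au=f$, and let $\delta_0>0$ and $(f_\delta)_{0<\delta<\delta_0}$ be a family of elements of $H$ with $\|f_\delta-f\|\le\delta$. Put $u_{\alpha,\delta}:=A^*Q_\alpha^{-1}f_\delta$. Then there exists a function $\alpha(\delta)>0$ such that $$\lim_{\delta\to 0}\alpha(\delta)=0\quad\text{and}\quad \lim_{\delta\to 0}\|u_\delta-y\|=0,\qquad u_\delta:=u_{\alpha(\delta),\delta}.$$ (iv) In the situation of (iii), let $C>1$ be a constant and assume that $\|f_\delta\|>C\delta$ for all $\delta\in(0,\delta_0)$. Then for each $\delta\in(0,\delta_0)$ the equation $$\|Au_{\alpha,\delta}-f_\delta\|=C\delta$$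 has a unique solution $\alpha=\alpha(\delta)>0$, and for this $\alpha(\delta)$ one has $\lim_{\delta\to0}\alpha(\delta)=0$ and $\lim_{\delta\to 0}\|u_{\alpha(\delta),\delta}-y\|=0$.
   Context: $D(\cdot)$, $R(\cdot)$, $N(\cdot)$ denote domain, range and null space, $A^*$ is the adjoint of $A$, and $I$ is the identity on $H$. "Not boundedly invertible" means that $A$ does not have a bounded inverse defined on all of $H$. The operators $T=A^*A$ and $Q=AA^*$ (with natural domains) are nonnegative, selfadjoint and densely defined, so for $\alpha>0$ the inverses $T_\alpha^{-1}$ and $Q_\alpha^{-1}$ are bounded and defined on all of $H$; the operator $A^*Q_\alpha^{-1}$ is bounded and defined on all of $H$; and the operator $T_\alpha^{-1}A^*$ with domain $D(A^* )$ is closable with closure a bounded operator defined on all of $H$. For $f\in R(A)$, the minimal-norm solution $y$ of $Au=f$ is the unique solution of minimal norm, equivalently the unique $y\in D(A)$ with $Ay=f$ and $y\perp N(A)$. *)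

theory Defs
  imports "HOL-Analysis.Analysis"
begin

text \<open>
  Scalar fields: the axioms force the field to be \<open>\<real>\<close> (with trivial conjugation) or
  \<open>\<complex>\<close> (with \<^const>\<open>cnj\<close>), so that real and complex Hilbert spaces are treated simultaneously.
\<close>

class real_or_complex = real_normed_field +
  fixes conjugate :: "'a \<Rightarrow> 'a"
  assumes conjugate_add: "conjugate (x + y) = conjugate x + conjugate y"
    and conjugate_mult: "conjugate (x * y) = conjugate x * conjugate y"
    and mult_conjugate: "x * conjugate x = (norm x)\<^sup>2 *\<^sub>R 1"

instantiation real :: real_or_complex
begin

definition conjugate_real :: "real \<Rightarrow> real" where
  "conjugate_real x = x"

instance
  by standard (simp_all add: conjugate_real_def power2_eq_square)

end

instantiation complex :: real_or_complex
begin

definition conjugate_complex :: "complex \<Rightarrow> complex" where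
  "conjugate_complex = cnj"

instance
proof
  fix x :: complex
  show "x * conjugate x = (norm x)\<^sup>2 *\<^sub>R 1"
    unfolding conjugate_complex_def scaleR_conv_of_real complex_norm_square by simp
qed (simp_all add: conjugate_complex_def)

end

locale hilbert_space = vector_space sc
  for sc :: "'k::real_or_complex \<Rightarrow> 'a::banach \<Rightarrow> 'a" +
  fixes ip :: "'a \<Rightarrow> 'a \<Rightarrow> 'k"
  assumes scale_of_real: "sc (of_real r) x = r *\<^sub>R x"
    and ip_add_left: "ip (x + y) z = ip x z + ip y z"
    and ip_scale_left: "ip (sc c x) y = c * ip x y"
    and ip_commute: "ip x y = conjugate (ip y x)"
    and ip_self: "ip x x = of_real ((norm x)\<^sup>2)"

lemma hilbert_space_real:
  "hilbert_space (scaleR :: real \<Rightarrow> 'a::{real_inner,banach} \<Rightarrow> 'a) inner"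
  by unfold_locales
    (simp_all add: scaleR_add_right scaleR_add_left inner_add_left inner_add_right
      conjugate_real_def inner_commute power2_norm_eq_inner)

lemma hilbert_space_complex:
  "hilbert_space ((*) :: complex \<Rightarrow> complex \<Rightarrow> complex) (\<lambda>x y. x * cnj y)"
proof unfold_locales
  fix x :: complex
  show "x * cnj x = of_real ((norm x)\<^sup>2)"
    by (rule complex_norm_square [symmetric])
qed (simp_all add: distrib_left distrib_right conjugate_complex_def scaleR_conv_of_real)

text \<open>
  An operator in \<open>H\<close> is identified with its graph, a set of pairs. Thus \<open>D(A)\<close> and \<open>R(A)\<close> are
  \<^term>\<open>Domain A\<close> and \<^term>\<open>Range A\<close>, the product \<open>BA\<close> (with its natural domain) is
  \<^term>\<open>A O B\<close>, the inverse is \<^term>\<open>A\<inverse>\<close>, a closed operator is one whose graph is closed, and the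
  closure of a closable operator is the topological closure of its graph.
\<close>

definition linear_operator :: "('k \<Rightarrow> 'a \<Rightarrow> 'a) \<Rightarrow> ('a::ab_group_add \<times> 'a) set \<Rightarrow> bool" where
  "linear_operator sc A \<longleftrightarrow>
     single_valued A \<and> (0, 0) \<in> A \<and>
     (\<forall>x u y v. (x, u) \<in> A \<longrightarrow> (y, v) \<in> A \<longrightarrow> (x + y, u + v) \<in> A) \<and>
     (\<forall>c x u. (x, u) \<in> A \<longrightarrow> (sc c x, sc c u) \<in> A)"

definition apply_op :: "('a \<times> 'a) set \<Rightarrow> 'a \<Rightarrow> 'a" where
  "apply_op A x = (THE y. (x, y) \<in> A)"

definition everywhere_defined :: "('a \<times> 'a) set \<Rightarrow> bool" where
  "everywhere_defined A \<longleftrightarrow> single_valued A \<and> Domain A = UNIV"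

definition bounded_op :: "('a::real_normed_vector \<times> 'a) set \<Rightarrow> bool" where
  "bounded_op A \<longleftrightarrow> (\<exists>K. \<forall>(x, y) \<in> A. norm y \<le> K * norm x)"

definition boundedly_invertible :: "('a::real_normed_vector \<times> 'a) set \<Rightarrow> bool" where
  "boundedly_invertible A \<longleftrightarrow> everywhere_defined (A\<inverse>) \<and> bounded_op (A\<inverse>)"

definition adjoint_op :: "('a \<Rightarrow> 'a \<Rightarrow> 'k) \<Rightarrow> ('a \<times> 'a) set \<Rightarrow> ('a \<times> 'a) set" where
  "adjoint_op ip A = {(y, z). \<forall>(x, w) \<in> A. ip w y = ip x z}"

definition shift_op :: "('a::real_vector \<times> 'a) set \<Rightarrow> real \<Rightarrow> ('a \<times> 'a) set" where
  "shift_op S \<alpha> = {(x, y + \<alpha> *\<^sub>R x) | x y. (x, y) \<in> S}"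

definition T_shift :: "('a \<Rightarrow> 'a \<Rightarrow> 'k) \<Rightarrow> ('a::real_vector \<times> 'a) set \<Rightarrow> real \<Rightarrow> ('a \<times> 'a) set" where
  "T_shift ip A \<alpha> = shift_op (A O adjoint_op ip A) \<alpha>"

definition Q_shift :: "('a \<Rightarrow> 'a \<Rightarrow> 'k) \<Rightarrow> ('a::real_vector \<times> 'a) set \<Rightarrow> real \<Rightarrow> ('a \<times> 'a) set" where
  "Q_shift ip A \<alpha> = shift_op (adjoint_op ip A O A) \<alpha>"

text \<open>The operator \<open>A\<^sup>* Q\<^sub>\<alpha>\<^sup>-\<^sup>1\<close>.\<close>

definition reg_op :: "('a \<Rightarrow> 'a \<Rightarrow> 'k) \<Rightarrow> ('a::real_vector \<times> 'a) set \<Rightarrow> real \<Rightarrow> ('a \<times> 'a) set" where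
  "reg_op ip A \<alpha> = (Q_shift ip A \<alpha>)\<inverse> O adjoint_op ip A"

text \<open>The closure of \<open>T\<^sub>\<alpha>\<^sup>-\<^sup>1 A\<^sup>*\<close>, the latter having domain \<open>D(A\<^sup>*)\<close>.\<close>

definition reg_op' ::
    "('a \<Rightarrow> 'a \<Rightarrow> 'k) \<Rightarrow> ('a::real_normed_vector \<times> 'a) set \<Rightarrow> real \<Rightarrow> ('a \<times> 'a) set" where
  "reg_op' ip A \<alpha> = closure (adjoint_op ip A O (T_shift ip A \<alpha>)\<inverse>)"

definition functional_F :: "('a::real_normed_vector \<times> 'a) set \<Rightarrow> 'a \<Rightarrow> real \<Rightarrow> 'a \<Rightarrow> real" where
  "functional_F A f \<alpha> u = (norm (apply_op A u - f))\<^sup>2 + \<alpha> * (norm u)\<^sup>2"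

definition global_minimizer ::
    "('a::real_normed_vector \<times> 'a) set \<Rightarrow> 'a \<Rightarrow> real \<Rightarrow> 'a \<Rightarrow> bool" where
  "global_minimizer A f \<alpha> u \<longleftrightarrow> is_arg_min (functional_F A f \<alpha>) (\<lambda>v. v \<in> Domain A) u"

definition min_norm_solution :: "('a::real_normed_vector \<times> 'a) set \<Rightarrow> 'a \<Rightarrow> 'a" where
  "min_norm_solution A f = (THE y. is_arg_min norm (\<lambda>u. (u, f) \<in> A) y)"

end

theory Submission
  imports Defs
begin

text \<open>
  The adjoint depends only on the real part of the inner product, so the scalar field may be
  taken to be \<open>\<real>\<close>. Projecting \<open>(0, f)\<close> orthogonally onto the graph of \<open>A\<close>, with
  the first component weighted by \<open>\<alpha>\<close>, yields \<open>u\<close> with \<open>A\<^sup>*(f - Au) = \<alpha>u\<close>. This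
  normal equation says both that \<open>u\<close> minimizes \<open>F\<close> and that \<open>u = A\<^sup>*Q\<^sub>\<alpha>\<^sup>-\<^sup>1f\<close>; no spectral theory
  is needed.

  The minimal-norm solution \<open>y\<close> lies in the closure of \<open>R(A\<^sup>*)\<close>. Therefore \<open>Au \<rightarrow> f\<close> together with
  \<open>\<parallel>u\<parallel> \<le> \<parallel>y\<parallel>\<close> forces \<open>u \<rightarrow> y\<close>, and comparing \<open>F(u)\<close> with \<open>F(y)\<close> provides both conditions, for exact
  data as well as under the discrepancy principle. For noisy data \<open>\<alpha>(\<delta>) = \<delta>\<close> works in (iii), since
  \<open>\<parallel>A\<^sup>*Q\<^sub>\<alpha>\<^sup>-\<^sup>1\<parallel> \<le> \<alpha>\<^sup>-\<^sup>1\<^sup>/\<^sup>2\<close>. In (iv) the discrepancy \<open>\<parallel>Au - f\<^sub>\<delta>\<parallel>\<close> is continuous and strictly increasing in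
  \<open>\<alpha>\<close>, below \<open>C\<delta>\<close> for small \<open>\<alpha>\<close> and close to \<open>\<parallel>f\<^sub>\<delta>\<parallel>\<close> for large \<open>\<alpha>\<close>.
\<close>

section \<open>Orthogonal projection and density in a real Hilbert space\<close>

lemma subspace_closure:
  fixes S :: "'a::real_normed_vector set"
  assumes "subspace S"
  shows "subspace (closure S)"
proof (rule subspaceI)
  show "0 \<in> closure S" using assms closure_subset subspace_0 by blast
next
  fix x y assume "x \<in> closure S" "y \<in> closure S"
  then obtain X Y where "\<And>n. X n \<in> S" "X \<longlonglongrightarrow> x" "\<And>n. Y n \<in> S" "Y \<longlonglongrightarrow> y"
    unfolding closure_sequential by auto
  then have "\<forall>n. X n + Y n \<in> S" "(\<lambda>n. X n + Y n) \<longlonglongrightarrow> x + y"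
    using assms by (auto intro: tendsto_add subspace_add)
  then show "x + y \<in> closure S" unfolding closure_sequential by (intro exI[of _ "\<lambda>n. X n + Y n"]) blast
next
  fix c x assume "x \<in> closure S"
  then obtain X where "\<And>n. X n \<in> S" "X \<longlonglongrightarrow> x" unfolding closure_sequential by auto
  then have "\<forall>n. c *\<^sub>R X n \<in> S" "(\<lambda>n. c *\<^sub>R X n) \<longlonglongrightarrow> c *\<^sub>R x"
    using assms by (auto intro: tendsto_scaleR subspace_scale)
  then show "c *\<^sub>R x \<in> closure S" unfolding closure_sequential by (intro exI[of _ "\<lambda>n. c *\<^sub>R X n"]) blast
qed

text \<open>The inner product is a parameter tied to the norm by \<open>self\<close>, so that the
  same geometry serves the real part of the given inner product and the product structure on
  pairs.\<close>

locale real_inner_product =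
  fixes ip :: "'a::banach \<Rightarrow> 'a \<Rightarrow> real"
  assumes commute: "ip x y = ip y x"
    and add_left: "ip (x + y) z = ip x z + ip y z"
    and scaleR_left: "ip (r *\<^sub>R x) y = r * ip x y"
    and self: "ip x x = (norm x)\<^sup>2"
begin

lemma add_right: "ip z (x + y) = ip z x + ip z y"
  by (simp add: commute[of z] add_left)

lemma scaleR_right: "ip y (r *\<^sub>R x) = r * ip y x"
  by (simp add: commute[of y] scaleR_left)

lemma minus_left: "ip (- x) y = - ip x y"
  using scaleR_left[of "-1" x y] by simp

lemma minus_right: "ip y (- x) = - ip y x"
  by (simp add: commute[of y] minus_left)

lemma diff_left: "ip (x - y) z = ip x z - ip y z"
  using add_left[of x "- y" z] by (simp add: minus_left)

lemma diff_right: "ip z (x - y) = ip z x - ip z y"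
  by (simp add: commute[of z] diff_left)

lemma zero_left: "ip 0 x = 0"
  using scaleR_left[of 0 0 x] by simp

lemma zero_right: "ip x 0 = 0"
  by (simp add: commute[of x] zero_left)

lemmas bilinear = add_left add_right scaleR_left scaleR_right minus_left minus_right
  diff_left diff_right zero_left zero_right

lemma norm_add_sq: "(norm (x + y))\<^sup>2 = (norm x)\<^sup>2 + 2 * ip x y + (norm y)\<^sup>2"
  unfolding self[symmetric] by (simp add: bilinear commute[of y x])

lemma norm_diff_sq: "(norm (x - y))\<^sup>2 = (norm x)\<^sup>2 - 2 * ip x y + (norm y)\<^sup>2"
  unfolding self[symmetric] by (simp add: bilinear commute[of y x])

lemma Cauchy_Schwarz: "\<bar>ip x y\<bar> \<le> norm x * norm y"
proof (cases "y = 0")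
  case True
  then show ?thesis by (simp add: zero_right)
next
  case False
  \<comment> \<open>Up to the factor \<open>(norm y)\<^sup>2\<close>, this vector is the component
    of \<open>x\<close> orthogonal to \<open>y\<close>.\<close>
  have "0 \<le> (norm ((norm y)\<^sup>2 *\<^sub>R x - ip x y *\<^sub>R y))\<^sup>2" by simp
  also have "\<dots> = (norm y)\<^sup>2 * ((norm x)\<^sup>2 * (norm y)\<^sup>2 - (ip x y)\<^sup>2)"
    unfolding norm_diff_sq by (simp add: bilinear power_mult_distrib) (simp add: algebra_simps power2_eq_square power4_eq_xxxx)
  finally have "(ip x y)\<^sup>2 \<le> (norm x * norm y)\<^sup>2"
    using False by (simp add: zero_le_mult_iff power_mult_distrib)
  then show ?thesis
    by (metis abs_le_square_iff abs_mult abs_norm_cancel)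
qed

lemma ip_le: "ip x y \<le> norm x * norm y"
  using Cauchy_Schwarz[of x y] by linarith

text \<open>A minimizing sequence for the distance to \<open>S\<close> is Cauchy by the
  parallelogram law; closedness keeps its limit in \<open>S\<close>, and minimality along each line
  through the limit gives orthogonality.\<close>

lemma projection_exists:
  assumes S: "subspace S" "closed S"
  obtains p where "p \<in> S" "\<And>x. x \<in> S \<Longrightarrow> ip (h - p) x = 0"
proof -
  define d where "d = infdist h S"
  have ne: "S \<noteq> {}" using S(1) subspace_0 by blast
  have d0: "d \<ge> 0" by (simp add: d_def infdist_nonneg)
  have low: "d \<le> norm (h - x)" if "x \<in> S" for x
    using infdist_le[OF that, of h] by (simp add: d_def dist_norm)
  have "\<exists>x\<in>S. norm (h - x) < d + inverse (real (Suc n))" for n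
  proof -
    have "(INF x\<in>S. dist h x) < d + inverse (real (Suc n))"
      using ne by (simp add: d_def infdist_notempty)
    then show ?thesis
      using ne cInf_lessD[of "dist h ` S"] by (auto simp: dist_norm)
  qed
  then obtain X where X: "\<And>n. X n \<in> S" "\<And>n. norm (h - X n) < d + inverse (real (Suc n))"
    by metis
  have lim: "(\<lambda>n. norm (h - X n)) \<longlonglongrightarrow> d"
    by (rule tendsto_sandwich[OF _ _ tendsto_const LIMSEQ_inverse_real_of_nat_add])
      (use X low in \<open>auto intro: always_eventually less_imp_le\<close>)
  \<comment> \<open>Parallelogram law for \<open>h - X m\<close> and \<open>h - X n\<close>: their
    midpoint has norm at least \<open>d\<close> because the mean of \<open>X m\<close> and
    \<open>X n\<close> lies in \<open>S\<close>.\<close>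
  have par: "(norm (X m - X n))\<^sup>2 \<le> 2 * (norm (h - X m))\<^sup>2 + 2 * (norm (h - X n))\<^sup>2 - 4 * d\<^sup>2" for m n
  proof -
    have "(1/2) *\<^sub>R (X m + X n) \<in> S"
      using S(1) X(1) by (simp add: subspace_add subspace_scale)
    then have "d\<^sup>2 \<le> (norm (h - (1/2) *\<^sub>R (X m + X n)))\<^sup>2"
      using low d0 by (meson power_mono)
    moreover have "4 * (norm (h - (1/2) *\<^sub>R (X m + X n)))\<^sup>2 + (norm (X m - X n))\<^sup>2
        = 2 * (norm (h - X m))\<^sup>2 + 2 * (norm (h - X n))\<^sup>2"
      unfolding self[symmetric]
      by (simp add: bilinear commute[of "X m" h] commute[of "X n" h] commute[of "X n" "X m"] algebra_simps)
    ultimately show ?thesis by linarith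
  qed
  have "Cauchy X"
  proof (rule CauchyI)
    fix e :: real assume e: "e > 0"
    have "(\<lambda>n. (norm (h - X n))\<^sup>2) \<longlonglongrightarrow> d\<^sup>2" by (intro tendsto_intros lim)
    \<comment> \<open>The slack \<open>e\<^sup>2 / 4\<close> enters \<open>par\<close> with total
      weight 4, which gives \<open>e\<^sup>2\<close>.\<close>
    moreover have "d\<^sup>2 < d\<^sup>2 + e\<^sup>2 / 4" using e by simp
    ultimately have "\<forall>\<^sub>F n in sequentially. (norm (h - X n))\<^sup>2 < d\<^sup>2 + e\<^sup>2 / 4"
      by (rule order_tendstoD)
    then obtain N where N: "\<And>n. n \<ge> N \<Longrightarrow> (norm (h - X n))\<^sup>2 < d\<^sup>2 + e\<^sup>2 / 4"
      by (auto simp: eventually_sequentially)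
    have "norm (X m - X n) < e" if "m \<ge> N" "n \<ge> N" for m n
    proof -
      have "(norm (X m - X n))\<^sup>2 < e\<^sup>2"
        using par[of m n] N[OF that(1)] N[OF that(2)] by linarith
      then show ?thesis using e by (simp add: power_less_imp_less_base)
    qed
    then show "\<exists>M. \<forall>m\<ge>M. \<forall>n\<ge>M. norm (X m - X n) < e" by blast
  qed
  then obtain p where p: "X \<longlonglongrightarrow> p" using Cauchy_convergent convergent_def by blast
  have pS: "p \<in> S" using S(2) X(1) p closed_sequentially by blast
  have "(\<lambda>n. norm (h - X n)) \<longlonglongrightarrow> norm (h - p)" by (intro tendsto_intros p)
  then have pd: "norm (h - p) = d" using lim LIMSEQ_unique by blast
  have "ip (h - p) x = 0" if x: "x \<in> S" for x
  proof (cases "x = 0")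
    case True
    then show ?thesis by (simp add: zero_right)
  next
    case False
    \<comment> \<open>This \<open>t\<close> minimizes the quadratic
      \<open>(norm (h - p - t *\<^sub>R x))\<^sup>2\<close>.\<close>
    define t where "t = ip (h - p) x / (norm x)\<^sup>2"
    have "p + t *\<^sub>R x \<in> S" using S(1) pS x by (simp add: subspace_add subspace_scale)
    then have "d\<^sup>2 \<le> (norm (h - p - t *\<^sub>R x))\<^sup>2"
      using low d0 by (metis diff_diff_eq power_mono)
    also have "\<dots> = d\<^sup>2 - 2 * t * ip (h - p) x + t\<^sup>2 * (norm x)\<^sup>2"
      unfolding norm_diff_sq[of "h - p"] by (simp add: pd bilinear power_mult_distrib)
    also have "t\<^sup>2 * (norm x)\<^sup>2 = t * ip (h - p) x"
      using False by (simp add: t_def power2_eq_square)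
    finally have "t * ip (h - p) x \<le> 0" by simp
    then have "(ip (h - p) x)\<^sup>2 \<le> 0"
      using False mult_nonpos_nonneg[of "t * ip (h - p) x" "(norm x)\<^sup>2"]
      by (simp add: t_def power2_eq_square)
    then show ?thesis by simp
  qed
  with pS show ?thesis using that by blast
qed

text \<open>For \<open>x\<close> in \<open>D\<close> closer to \<open>d\<close> than
  \<open>norm d\<close>, orthogonality gives |d|^2 = <d - x, d>, which Cauchy-Schwarz makes smaller
  than |d|^2.\<close>

lemma orthogonal_dense_imp_zero:
  assumes "closure D = UNIV" "\<And>x. x \<in> D \<Longrightarrow> ip x d = 0"
  shows "d = 0"
proof (rule ccontr)
  assume "d \<noteq> 0"
  moreover have "d \<in> closure D" using assms(1) by simp
  ultimately obtain x where x: "x \<in> D" "norm (d - x) < norm d"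
    by (metis closure_approachable dist_commute dist_norm zero_less_norm_iff)
  have "(norm d)\<^sup>2 = ip (d - x) d"
    using assms(2)[OF x(1)] by (simp add: diff_left self)
  also have "\<dots> \<le> norm (d - x) * norm d" by (rule ip_le)
  also have "\<dots> < (norm d)\<^sup>2"
    using x(2) \<open>d \<noteq> 0\<close> by (simp add: power2_eq_square)
  finally show False by simp
qed

lemma dense_if_orthogonal_trivial:
  assumes "subspace D" "\<And>d. (\<And>x. x \<in> D \<Longrightarrow> ip d x = 0) \<Longrightarrow> d = 0"
  shows "closure D = UNIV"
proof -
  have "h \<in> closure D" for h
  proof -
    obtain p where p: "p \<in> closure D" "\<And>x. x \<in> closure D \<Longrightarrow> ip (h - p) x = 0"
      using projection_exists[of "closure D" h] assms(1) subspace_closure by blast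
    then have "h - p = 0" using assms(2) closure_subset by blast
    with p show ?thesis by simp
  qed
  then show ?thesis by blast
qed

end

text \<open>Graphs are subsets of the space of pairs, whose norm is Euclidean; this makes
  \<open>projection_exists\<close> available for graphs.\<close>

lemma real_inner_product_prod:
  assumes "real_inner_product ip"
  shows "real_inner_product (\<lambda>p q. ip (fst p) (fst q) + ip (snd p) (snd q))"
proof -
  interpret real_inner_product ip by fact
  show ?thesis
    by unfold_locales (auto simp: bilinear self norm_prod_def commute algebra_simps)
qed

lemma apply_op_eqI: "everywhere_defined B \<Longrightarrow> (x, y) \<in> B \<Longrightarrow> apply_op B x = y"
  unfolding everywhere_defined_def apply_op_def by (auto dest: single_valuedD)

section \<open>The adjoint and the normal equation of a closed, densely defined operator\<close>

locale closed_dense_operator = real_inner_product ip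
  for ip :: "'a::banach \<Rightarrow> 'a \<Rightarrow> real" +
  fixes A :: "('a \<times> 'a) set"
  assumes linear_operator: "linear_operator (*\<^sub>R) A"
    and closed: "closed A"
    and dense_Domain: "closure (Domain A) = UNIV"
begin

abbreviation Adj :: "('a \<times> 'a) set" where
  "Adj \<equiv> adjoint_op ip A"

lemma subspace_A: "subspace A"
  using linear_operator unfolding linear_operator_def subspace_def
  by (auto simp: zero_prod_def)

lemma A_diff: "(x, w) \<in> A \<Longrightarrow> (x', w') \<in> A \<Longrightarrow> (x - x', w - w') \<in> A"
  using subspace_diff[OF subspace_A, of "(x, w)" "(x', w')"] by simp

lemma A_unique: "(x, w) \<in> A \<Longrightarrow> (x, w') \<in> A \<Longrightarrow> w = w'"
  using linear_operator unfolding linear_operator_def by (auto dest: single_valuedD)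

lemma A_zero: "(0, 0) \<in> A"
  using linear_operator unfolding linear_operator_def by auto

lemma apply_op_A: "(x, w) \<in> A \<Longrightarrow> apply_op A x = w"
  unfolding apply_op_def using A_unique by blast

lemma adjoint_eq: "(x, w) \<in> A \<Longrightarrow> (y, z) \<in> Adj \<Longrightarrow> ip w y = ip x z"
  unfolding adjoint_op_def by auto

lemma subspace_Adj: "subspace Adj"
  unfolding subspace_def adjoint_op_def by (fastforce simp: bilinear zero_prod_def)

lemma Adj_diff: "(x, w) \<in> Adj \<Longrightarrow> (x', w') \<in> Adj \<Longrightarrow> (x - x', w - w') \<in> Adj"
  using subspace_diff[OF subspace_Adj, of "(x, w)" "(x', w')"] by simp

lemma Adj_scaleR: "(x, w) \<in> Adj \<Longrightarrow> (c *\<^sub>R x, c *\<^sub>R w) \<in> Adj"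
  using subspace_scale[OF subspace_Adj, of "(x, w)" c] by simp

lemma Adj_scaleR_iff: "c \<noteq> 0 \<Longrightarrow> (c *\<^sub>R x, c *\<^sub>R w) \<in> Adj \<longleftrightarrow> (x, w) \<in> Adj"
  using Adj_scaleR[of x w c] Adj_scaleR[of "c *\<^sub>R x" "c *\<^sub>R w" "inverse c"] by auto

lemma Adj_minus: "(x, w) \<in> Adj \<Longrightarrow> (- x, - w) \<in> Adj"
  using Adj_scaleR[of x w "-1"] by simp

text \<open>Density of D(A) enters here: two values of the adjoint at \<open>y\<close> differ by a
  vector orthogonal to D(A).\<close>

lemma Adj_unique:
  assumes "(y, z) \<in> Adj" "(y, z') \<in> Adj"
  shows "z = z'"
proof -
  have "ip x (z - z') = 0" if "x \<in> Domain A" for x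
    using that adjoint_eq[OF _ assms(1)] adjoint_eq[OF _ assms(2)] by (auto simp: diff_right)
  then show ?thesis using orthogonal_dense_imp_zero[OF dense_Domain, of "z - z'"] by simp
qed

text \<open>The orthogonal projection of \<open>(h, f)\<close> onto the graph of \<open>A\<close>, in the norm
  \<open>\<alpha>\<parallel>u\<parallel>\<^sup>2 + \<parallel>w\<parallel>\<^sup>2\<close> of \<open>H \<times> H\<close>.\<close>

lemma normal_equation_solvable:
  assumes "\<alpha> > 0"
  obtains u w where "(u, w) \<in> A" "(f - w, \<alpha> *\<^sub>R (u - h)) \<in> Adj"
proof -
  interpret P: real_inner_product "\<lambda>p q. ip (fst p) (fst q) + ip (snd p) (snd q)"
    by (rule real_inner_product_prod) unfold_locales
  \<comment> \<open>The map (u, w) -> (s u, w) carries \<open>A\<close> to \<open>G\<close> and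
    turns the weighted norm into the ordinary norm of pairs, where \<open>projection_exists\<close>
    applies to the point (s h, f).\<close>
  define s where "s = sqrt \<alpha>"
  have s: "s > 0" "s * s = \<alpha>" using assms by (auto simp: s_def)
  define G where "G = {(x, w). ((1 / s) *\<^sub>R x, w) \<in> A}"
  have G: "G = (\<lambda>p. ((1 / s) *\<^sub>R fst p, snd p)) -` A" by (auto simp: G_def)
  have "linear (\<lambda>p :: 'a \<times> 'a. ((1 / s) *\<^sub>R fst p, snd p))"
    by (rule linearI) (auto simp: scaleR_add_right)
  then have "subspace G" unfolding G by (rule linear_subspace_vimage[OF _ subspace_A])
  moreover have "closed G"
    unfolding G using closed by (auto intro!: closed_vimage continuous_intros)
  ultimately obtain p where p: "p \<in> G"
    "\<And>x. x \<in> G \<Longrightarrow> ip (fst ((s *\<^sub>R h, f) - p)) (fst x) + ip (snd ((s *\<^sub>R h, f) - p)) (snd x) = 0"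
    using P.projection_exists[of G "(s *\<^sub>R h, f)"] by blast
  define u where "u = (1 / s) *\<^sub>R fst p"
  define w where "w = snd p"
  have pu: "fst p = s *\<^sub>R u" using s by (simp add: u_def)
  have "(u, w) \<in> A" using p(1) by (auto simp: G_def u_def w_def)
  moreover have "ip z (f - w) = ip x (\<alpha> *\<^sub>R (u - h))" if "(x, z) \<in> A" for x z
  proof -
    have "(s *\<^sub>R x, z) \<in> G" using that s by (simp add: G_def)
    from p(2)[OF this] have "ip (s *\<^sub>R h - s *\<^sub>R u) (s *\<^sub>R x) + ip (f - w) z = 0"
      by (simp add: pu w_def)
    then show ?thesis
      by (simp add: bilinear commute[of x] commute[of z] s(2)[symmetric] algebra_simps)
  qed
  then have "(f - w, \<alpha> *\<^sub>R (u - h)) \<in> Adj" by (auto simp: adjoint_op_def)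
  ultimately show ?thesis using that by blast
qed

text \<open>Pairing the difference of the two graph elements with the difference of the two adjoint
  pairs gives -|w - w'|^2 = \<alpha> |u - u'|^2, so both sides vanish.\<close>

lemma normal_equation_unique:
  assumes "\<alpha> > 0" "(u, w) \<in> A" "(f - w, \<alpha> *\<^sub>R (u - h)) \<in> Adj"
    "(u', w') \<in> A" "(f - w', \<alpha> *\<^sub>R (u' - h)) \<in> Adj"
  shows "u = u'" "w = w'"
proof -
  have "ip (w - w') ((f - w) - (f - w')) = ip (u - u') (\<alpha> *\<^sub>R (u - h) - \<alpha> *\<^sub>R (u' - h))"
    using assms by (blast intro: adjoint_eq A_diff Adj_diff)
  moreover have "(f - w) - (f - w') = - (w - w')"
    "\<alpha> *\<^sub>R (u - h) - \<alpha> *\<^sub>R (u' - h) = \<alpha> *\<^sub>R (u - u')"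
    by (auto simp: algebra_simps)
  ultimately have "- (norm (w - w'))\<^sup>2 = \<alpha> * (norm (u - u'))\<^sup>2"
    by (metis minus_right scaleR_right self)
  then have "(norm (w - w'))\<^sup>2 + \<alpha> * (norm (u - u'))\<^sup>2 = 0" by linarith
  then have "(norm (w - w'))\<^sup>2 = 0 \<and> \<alpha> * (norm (u - u'))\<^sup>2 = 0"
    using assms(1) by (subst (asm) add_nonneg_eq_0_iff) auto
  then show "u = u'" "w = w'" using assms(1) by auto
qed

section \<open>The inverses of T + \<alpha> I and Q + \<alpha> I, and the regularizing
  operator\<close>

lemma everywhere_defined_T_shift_inverse:
  assumes "\<alpha> > 0"
  shows "everywhere_defined ((T_shift ip A \<alpha>)\<inverse>)"
proof -
  \<comment> \<open>T x + \<alpha> x = \<alpha> h is the normal equation for the point (h, 0), with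
    w = A x and A^*(-w) = \<alpha> (x - h). Every right-hand side has the form \<alpha> h, as
    \<alpha> is positive.\<close>
  have T_iff: "(x, \<alpha> *\<^sub>R h) \<in> T_shift ip A \<alpha> \<longleftrightarrow>
      (\<exists>w. (x, w) \<in> A \<and> (0 - w, \<alpha> *\<^sub>R (x - h)) \<in> Adj)" for x h
  proof -
    have "(x, \<alpha> *\<^sub>R h) \<in> T_shift ip A \<alpha> \<longleftrightarrow> (\<exists>w. (x, w) \<in> A \<and> (w, - (\<alpha> *\<^sub>R (x - h))) \<in> Adj)"
      unfolding T_shift_def shift_op_def
      by (auto simp: relcomp_unfold algebra_simps) (metis add_diff_cancel_right' diff_add_cancel)+
    also have "\<dots> \<longleftrightarrow> (\<exists>w. (x, w) \<in> A \<and> (0 - w, \<alpha> *\<^sub>R (x - h)) \<in> Adj)"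
      using Adj_minus by (metis diff_0 minus_minus)
    finally show ?thesis .
  qed
  have unique: "x = x'" if x: "(x, \<alpha> *\<^sub>R h) \<in> T_shift ip A \<alpha>" "(x', \<alpha> *\<^sub>R h) \<in> T_shift ip A \<alpha>" for x x' h
    using x normal_equation_unique(1)[OF assms, of _ _ 0 h] unfolding T_iff by blast
  have "x = x'" if "(x, f) \<in> T_shift ip A \<alpha>" "(x', f) \<in> T_shift ip A \<alpha>" for x x' f
    using that unique[of x "(1 / \<alpha>) *\<^sub>R f" x'] assms by simp
  moreover have "\<exists>x. (x, f) \<in> T_shift ip A \<alpha>" for f
  proof -
    have "\<exists>x. (x, \<alpha> *\<^sub>R ((1 / \<alpha>) *\<^sub>R f)) \<in> T_shift ip A \<alpha>"
      unfolding T_iff using normal_equation_solvable[OF assms] by blast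
    then show ?thesis using assms by simp
  qed
  ultimately show ?thesis
    unfolding everywhere_defined_def single_valued_def by blast
qed

text \<open>With u = A^* v and w = A u, the equation Q v + \<alpha> v = f says that the residual f -
  w is \<alpha> v; applying A^* gives the normal equation with h = 0, listed separately so that
  solvability and uniqueness apply directly.\<close>

lemma Q_shift_iff:
  assumes "\<alpha> > 0"
  shows "(v, f) \<in> Q_shift ip A \<alpha> \<longleftrightarrow>
    (\<exists>u w. (u, w) \<in> A \<and> (f - w, \<alpha> *\<^sub>R u) \<in> Adj \<and> (v, u) \<in> Adj \<and> f - w = \<alpha> *\<^sub>R v)"
    (is "?L \<longleftrightarrow> ?R")
proof
  assume ?L
  then obtain u w where "(v, u) \<in> Adj" "(u, w) \<in> A" "f = w + \<alpha> *\<^sub>R v"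
    unfolding Q_shift_def shift_op_def by blast
  then show ?R using Adj_scaleR by fastforce
next
  assume ?R
  then obtain u w where "(u, w) \<in> A" "(v, u) \<in> Adj" "f = w + \<alpha> *\<^sub>R v"
    by (auto simp: algebra_simps)
  then show ?L unfolding Q_shift_def shift_op_def by blast
qed

lemma everywhere_defined_Q_shift_inverse:
  assumes "\<alpha> > 0"
  shows "everywhere_defined ((Q_shift ip A \<alpha>)\<inverse>)"
proof -
  have "v = v'" if vv': "(v, f) \<in> Q_shift ip A \<alpha>" "(v', f) \<in> Q_shift ip A \<alpha>" for v v' f
  proof -
    obtain u w where "(u, w) \<in> A" "(f - w, \<alpha> *\<^sub>R (u - 0)) \<in> Adj" "f - w = \<alpha> *\<^sub>R v"
      using vv'(1) unfolding Q_shift_iff[OF assms] diff_zero by metis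
    moreover obtain u' w' where
      "(u', w') \<in> A" "(f - w', \<alpha> *\<^sub>R (u' - 0)) \<in> Adj" "f - w' = \<alpha> *\<^sub>R v'"
      using vv'(2) unfolding Q_shift_iff[OF assms] diff_zero by metis
    ultimately have "\<alpha> *\<^sub>R v = \<alpha> *\<^sub>R v'" using normal_equation_unique(2)[OF assms] by metis
    then show ?thesis using assms by simp
  qed
  moreover have "\<exists>v. (v, f) \<in> Q_shift ip A \<alpha>" for f
  proof -
    obtain u w where uw: "(u, w) \<in> A" "(f - w, \<alpha> *\<^sub>R u) \<in> Adj"
      using normal_equation_solvable[OF assms, of f 0] by auto
    define v where "v = (1 / \<alpha>) *\<^sub>R (f - w)"
    have v: "f - w = \<alpha> *\<^sub>R v" using assms by (simp add: v_def)
    then have "(v, u) \<in> Adj" using uw(2) assms Adj_scaleR_iff[of \<alpha> v u] by simp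
    then show ?thesis using Q_shift_iff[OF assms] uw v by blast
  qed
  ultimately show ?thesis
    unfolding everywhere_defined_def single_valued_def by blast
qed

text \<open>Eliminating v = (f - w) / \<alpha> leaves only the normal equation, the form in which
  the regularized solution is handled from here on.\<close>

lemma reg_op_iff:
  assumes "\<alpha> > 0"
  shows "(f, u) \<in> reg_op ip A \<alpha> \<longleftrightarrow> (\<exists>w. (u, w) \<in> A \<and> (f - w, \<alpha> *\<^sub>R u) \<in> Adj)" (is "?L \<longleftrightarrow> ?R")
proof
  assume ?L
  then obtain v where v: "(v, f) \<in> Q_shift ip A \<alpha>" "(v, u) \<in> Adj"
    unfolding reg_op_def by blast
  then show ?R unfolding Q_shift_iff[OF assms] using Adj_unique by blast
next
  assume ?R
  then obtain w where uw: "(u, w) \<in> A" "(f - w, \<alpha> *\<^sub>R u) \<in> Adj" by blast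
  define v where "v = (1 / \<alpha>) *\<^sub>R (f - w)"
  have v: "f - w = \<alpha> *\<^sub>R v" using assms by (simp add: v_def)
  then have "(v, u) \<in> Adj" using uw(2) assms Adj_scaleR_iff[of \<alpha> v u] by simp
  then show ?L using Q_shift_iff[OF assms] uw v unfolding reg_op_def by blast
qed

lemma everywhere_defined_reg_op:
  assumes "\<alpha> > 0"
  shows "everywhere_defined (reg_op ip A \<alpha>)"
proof -
  have "u = u'" if "(f, u) \<in> reg_op ip A \<alpha>" "(f, u') \<in> reg_op ip A \<alpha>" for u u' f
    using that normal_equation_unique(1)[OF assms, of _ _ f 0] unfolding reg_op_iff[OF assms] by auto
  moreover have "\<exists>u. (f, u) \<in> reg_op ip A \<alpha>" for f
    using normal_equation_solvable[OF assms, of f 0] unfolding reg_op_iff[OF assms] by (metis diff_zero)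
  ultimately show ?thesis
    unfolding everywhere_defined_def single_valued_def by blast
qed

section \<open>The regularized solution and its residual\<close>

definition reg :: "real \<Rightarrow> 'a \<Rightarrow> 'a" where
  "reg \<alpha> f = apply_op (reg_op ip A \<alpha>) f"

text \<open>The sign is chosen so that A^* sends the residual to \<alpha> times the regularized
  solution.\<close>

definition residual :: "real \<Rightarrow> 'a \<Rightarrow> 'a" where
  "residual \<alpha> f = f - apply_op A (reg \<alpha> f)"

lemma reg_op_graph:
  assumes "\<alpha> > 0"
  shows "(f, u) \<in> reg_op ip A \<alpha> \<longleftrightarrow> u = reg \<alpha> f"
proof -
  have ev: "everywhere_defined (reg_op ip A \<alpha>)" by (rule everywhere_defined_reg_op[OF assms])
  then obtain u' where "(f, u') \<in> reg_op ip A \<alpha>" unfolding everywhere_defined_def by blast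
  then show ?thesis using apply_op_eqI[OF ev] unfolding reg_def by metis
qed

lemma
  assumes "\<alpha> > 0"
  shows reg_in_A: "(reg \<alpha> f, f - residual \<alpha> f) \<in> A"
    and residual_in_Adj: "(residual \<alpha> f, \<alpha> *\<^sub>R reg \<alpha> f) \<in> Adj"
proof -
  obtain w where w: "(reg \<alpha> f, w) \<in> A" "(f - w, \<alpha> *\<^sub>R reg \<alpha> f) \<in> Adj"
    using reg_op_graph[OF assms] reg_op_iff[OF assms] by metis
  then have "residual \<alpha> f = f - w" by (simp add: residual_def apply_op_A)
  with w show "(reg \<alpha> f, f - residual \<alpha> f) \<in> A" "(residual \<alpha> f, \<alpha> *\<^sub>R reg \<alpha> f) \<in> Adj" by auto
qed

lemma
  assumes "\<alpha> > 0" "(u, w) \<in> A" "(f - w, \<alpha> *\<^sub>R u) \<in> Adj"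
  shows reg_eqI: "reg \<alpha> f = u" and residual_eqI: "residual \<alpha> f = f - w"
proof -
  show "reg \<alpha> f = u" using assms reg_op_graph reg_op_iff by metis
  then show "residual \<alpha> f = f - w" using assms(2) by (simp add: residual_def apply_op_A)
qed

text \<open>Both are linear in the data because differences of solutions solve the normal equation
  for \<open>f - g\<close>, whose solution is unique.\<close>

lemma
  assumes "\<alpha> > 0"
  shows reg_diff: "reg \<alpha> (f - g) = reg \<alpha> f - reg \<alpha> g"
    and residual_diff: "residual \<alpha> (f - g) = residual \<alpha> f - residual \<alpha> g"
proof -
  have 1: "(reg \<alpha> f - reg \<alpha> g, (f - residual \<alpha> f) - (g - residual \<alpha> g)) \<in> A"
    using assms by (intro A_diff reg_in_A)
  have "(residual \<alpha> f - residual \<alpha> g, \<alpha> *\<^sub>R reg \<alpha> f - \<alpha> *\<^sub>R reg \<alpha> g) \<in> Adj"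
    using assms by (intro Adj_diff residual_in_Adj)
  then have 2: "(f - g - ((f - residual \<alpha> f) - (g - residual \<alpha> g)), \<alpha> *\<^sub>R (reg \<alpha> f - reg \<alpha> g)) \<in> Adj"
    by (simp add: algebra_simps)
  show "reg \<alpha> (f - g) = reg \<alpha> f - reg \<alpha> g" by (rule reg_eqI[OF assms 1 2])
  show "residual \<alpha> (f - g) = residual \<alpha> f - residual \<alpha> g"
    using residual_eqI[OF assms 1 2] by simp
qed

section \<open>The functional F and its minimizer\<close>

text \<open>This completes the square around the regularized solution: the two cross terms, <A d, r>
  and \<alpha> <d, u>, cancel by the normal equation. Minimality, uniqueness and the later
  monotonicity all rest on this identity.\<close>

lemma functional_expansion:
  assumes "\<alpha> > 0" "(v, z) \<in> A"
  shows "(norm (z - f))\<^sup>2 + \<alpha> * (norm v)\<^sup>2 =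
    (norm (residual \<alpha> f))\<^sup>2 + \<alpha> * (norm (reg \<alpha> f))\<^sup>2 +
    (norm (z - (f - residual \<alpha> f)))\<^sup>2 + \<alpha> * (norm (v - reg \<alpha> f))\<^sup>2"
proof -
  let ?r = "residual \<alpha> f" and ?u = "reg \<alpha> f"
  define d where "d = v - ?u"
  define e where "e = z - (f - ?r)"
  have "ip e ?r = ip d (\<alpha> *\<^sub>R ?u)"
    unfolding d_def e_def using assms by (blast intro: adjoint_eq A_diff reg_in_A residual_in_Adj)
  then have cross: "ip e ?r = \<alpha> * ip d ?u" by (simp add: scaleR_right)
  have "z - f = e - ?r" "v = d + ?u" by (auto simp: d_def e_def)
  then have "(norm (z - f))\<^sup>2 + \<alpha> * (norm v)\<^sup>2 = (norm (e - ?r))\<^sup>2 + \<alpha> * (norm (d + ?u))\<^sup>2" by simp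
  also have "\<dots> = (norm ?r)\<^sup>2 + \<alpha> * (norm ?u)\<^sup>2 + (norm e)\<^sup>2 + \<alpha> * (norm d)\<^sup>2"
    unfolding norm_diff_sq norm_add_sq using cross by (simp add: algebra_simps)
  finally show ?thesis by (simp add: d_def e_def)
qed

lemma functional_le:
  assumes "\<alpha> > 0" "(v, z) \<in> A"
  shows "(norm (residual \<alpha> f))\<^sup>2 + \<alpha> * (norm (reg \<alpha> f))\<^sup>2 \<le> (norm (z - f))\<^sup>2 + \<alpha> * (norm v)\<^sup>2"
  unfolding functional_expansion[OF assms] using assms(1) by simp

lemma functional_F_eq: "(v, z) \<in> A \<Longrightarrow> functional_F A f \<alpha> v = (norm (z - f))\<^sup>2 + \<alpha> * (norm v)\<^sup>2"
  unfolding functional_F_def by (simp add: apply_op_A)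

lemma functional_F_reg:
  "\<alpha> > 0 \<Longrightarrow> functional_F A f \<alpha> (reg \<alpha> f) = (norm (residual \<alpha> f))\<^sup>2 + \<alpha> * (norm (reg \<alpha> f))\<^sup>2"
  using functional_F_eq[OF reg_in_A] by simp

lemma global_minimizer_iff:
  assumes "\<alpha> > 0"
  shows "global_minimizer A f \<alpha> u \<longleftrightarrow> u = reg \<alpha> f"
proof
  assume u: "global_minimizer A f \<alpha> u"
  then obtain w where w: "(u, w) \<in> A" unfolding global_minimizer_def is_arg_min_def by blast
  have "functional_F A f \<alpha> u \<le> functional_F A f \<alpha> (reg \<alpha> f)"
    using u reg_in_A[OF assms] unfolding global_minimizer_def is_arg_min_def by (meson Domain.simps linorder_not_less)
  then have "(norm (w - (f - residual \<alpha> f)))\<^sup>2 + \<alpha> * (norm (u - reg \<alpha> f))\<^sup>2 \<le> 0"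
    unfolding functional_F_eq[OF w] functional_F_reg[OF assms] functional_expansion[OF assms w] by simp
  then have "\<alpha> * (norm (u - reg \<alpha> f))\<^sup>2 \<le> 0"
    using zero_le_power2[of "norm (w - (f - residual \<alpha> f))"] by linarith
  then show "u = reg \<alpha> f" using assms by (simp add: mult_le_0_iff)
next
  assume u: "u = reg \<alpha> f"
  have "functional_F A f \<alpha> (reg \<alpha> f) \<le> functional_F A f \<alpha> v" if "(v, z) \<in> A" for v z
    unfolding functional_F_eq[OF that] functional_F_reg[OF assms] by (rule functional_le[OF assms that])
  then show "global_minimizer A f \<alpha> u"
    using u reg_in_A[OF assms, of f] unfolding global_minimizer_def is_arg_min_def
    by (auto simp: not_less)
qed

text \<open>Both bounds come from comparing the minimum of F with its value |f|^2 at 0.\<close>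

lemma
  assumes "\<alpha> > 0"
  shows norm_residual_le: "norm (residual \<alpha> f) \<le> norm f"
    and norm_reg_le: "norm (reg \<alpha> f) \<le> norm f / sqrt \<alpha>"
proof -
  have *: "(norm (residual \<alpha> f))\<^sup>2 + \<alpha> * (norm (reg \<alpha> f))\<^sup>2 \<le> (norm f)\<^sup>2"
    using functional_le[OF assms A_zero, of f] by simp
  then have "(norm (residual \<alpha> f))\<^sup>2 \<le> (norm f)\<^sup>2"
    using assms by (smt (verit) mult_nonneg_nonneg zero_le_power2)
  then show "norm (residual \<alpha> f) \<le> norm f" by simp
  have "(sqrt \<alpha> * norm (reg \<alpha> f))\<^sup>2 \<le> (norm f)\<^sup>2"
    using * assms by (simp add: power_mult_distrib) (smt (verit) zero_le_power2)
  then have "sqrt \<alpha> * norm (reg \<alpha> f) \<le> norm f"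
    using norm_ge_zero power2_le_imp_le by blast
  then show "norm (reg \<alpha> f) \<le> norm f / sqrt \<alpha>" using assms by (simp add: field_simps)
qed

lemma isCont_reg:
  assumes "\<alpha> > 0"
  shows "isCont (reg \<alpha>) f"
  unfolding isCont_def
proof (rule LIM_I)
  fix e :: real assume "e > 0"
  have "norm (reg \<alpha> g - reg \<alpha> f) < e" if "norm (g - f) < e * sqrt \<alpha>" for g
    using norm_reg_le[OF assms, of "g - f"] that assms
    by (simp add: reg_diff pos_divide_less_eq order_le_less_trans)
  then show "\<exists>s>0. \<forall>g. g \<noteq> f \<and> norm (g - f) < s \<longrightarrow> norm (reg \<alpha> g - reg \<alpha> f) < e"
    using \<open>e > 0\<close> assms by (intro exI[of _ "e * sqrt \<alpha>"]) auto
qed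

lemma dense_Domain_Adj: "closure (Domain Adj) = UNIV"
proof (rule dense_if_orthogonal_trivial)
  have "linear (fst :: 'a \<times> 'a \<Rightarrow> 'a)" by (rule linear_fst)
  then show "subspace (Domain Adj)"
    unfolding Domain_fst by (rule linear_subspace_image[OF _ subspace_Adj])
next
  fix q assume q: "\<And>x. x \<in> Domain Adj \<Longrightarrow> ip q x = 0"
  let ?r = "residual 1 q" and ?u = "reg 1 q"
  have r: "(?r, ?u) \<in> Adj" using residual_in_Adj[of 1 q] by simp
  then have "ip q ?r = 0" using q by blast
  moreover have "ip (q - ?r) ?r = ip ?u ?u"
    using adjoint_eq[OF reg_in_A r] by simp
  ultimately have "(norm ?r)\<^sup>2 + (norm ?u)\<^sup>2 = 0" unfolding diff_left self by linarith
  then have "?r = 0" "?u = 0" by (simp_all add: add_nonneg_eq_0_iff)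
  then show "q = 0" using reg_in_A[of 1 q] A_zero A_unique by fastforce
qed

text \<open>For \<open>g \<in> D(A\<^sup>*)\<close> also \<open>r = g - Au\<close> and hence \<open>Au\<close> lie in \<open>D(A\<^sup>*)\<close>, so \<open>A\<^sup>*\<close> may be
  applied to \<open>Au + r = g\<close>.\<close>

lemma T_shift_inverse_Adj_iff:
  assumes "\<alpha> > 0"
  shows "(g, u) \<in> Adj O (T_shift ip A \<alpha>)\<inverse> \<longleftrightarrow> g \<in> Domain Adj \<and> u = reg \<alpha> g"
proof -
  have reg: "(g, reg \<alpha> g) \<in> Adj O (T_shift ip A \<alpha>)\<inverse>" if "(g, z) \<in> Adj" for g z
  proof -
    have "(g - residual \<alpha> g, z - \<alpha> *\<^sub>R reg \<alpha> g) \<in> Adj"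
      by (rule Adj_diff[OF that residual_in_Adj[OF assms]])
    then have "(reg \<alpha> g, z - \<alpha> *\<^sub>R reg \<alpha> g) \<in> A O Adj" using reg_in_A[OF assms] by blast
    then have "(reg \<alpha> g, z) \<in> T_shift ip A \<alpha>" unfolding T_shift_def shift_op_def by force
    then show ?thesis using that by blast
  qed
  have "single_valued (Adj O (T_shift ip A \<alpha>)\<inverse>)"
    using everywhere_defined_T_shift_inverse[OF assms] Adj_unique
    by (intro single_valued_relcomp) (auto simp: everywhere_defined_def single_valued_def)
  then show ?thesis using reg by (blast dest: single_valuedD)
qed

lemma reg_op'_eq:
  assumes "\<alpha> > 0"
  shows "reg_op' ip A \<alpha> = reg_op ip A \<alpha>"
proof -
  have "(g, u) \<in> reg_op' ip A \<alpha> \<longleftrightarrow> u = reg \<alpha> g" for g u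
  proof
    assume "(g, u) \<in> reg_op' ip A \<alpha>"
    then obtain X where X: "\<And>n. X n \<in> Adj O (T_shift ip A \<alpha>)\<inverse>" "X \<longlonglongrightarrow> (g, u)"
      unfolding reg_op'_def closure_sequential by blast
    have "snd (X n) = reg \<alpha> (fst (X n))" for n
      using X(1)[of n] T_shift_inverse_Adj_iff[OF assms, of "fst (X n)" "snd (X n)"] by simp
    moreover have "(\<lambda>n. reg \<alpha> (fst (X n))) \<longlonglongrightarrow> reg \<alpha> g"
      using isCont_tendsto_compose[OF isCont_reg[OF assms] tendsto_fst[OF X(2)]] by simp
    ultimately show "u = reg \<alpha> g"
      using tendsto_snd[OF X(2)] LIMSEQ_unique by fastforce
  next
    assume u: "u = reg \<alpha> g"
    have "g \<in> closure (Domain Adj)" using dense_Domain_Adj by simp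
    then obtain X where X: "\<And>n. X n \<in> Domain Adj" "X \<longlonglongrightarrow> g"
      unfolding closure_sequential by blast
    then have "(\<lambda>n. (X n, reg \<alpha> (X n))) \<longlonglongrightarrow> (g, u)"
      unfolding u by (intro tendsto_Pair isCont_tendsto_compose[OF isCont_reg[OF assms]])
    moreover have "(X n, reg \<alpha> (X n)) \<in> Adj O (T_shift ip A \<alpha>)\<inverse>" for n
      using X(1) T_shift_inverse_Adj_iff[OF assms] by blast
    ultimately show "(g, u) \<in> reg_op' ip A \<alpha>"
      unfolding reg_op'_def closure_sequential
      by (intro exI[of _ "\<lambda>n. (X n, reg \<alpha> (X n))"]) blast
  qed
  then show ?thesis using reg_op_graph[OF assms] by auto
qed

section \<open>The minimal-norm solution\<close>

text \<open>Subtracting from any solution its projection onto the closed subspace N(A) gives a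
  solution orthogonal to N(A); Pythagoras then makes it the only one of least norm.\<close>

lemma
  assumes "f \<in> Range A"
  shows min_norm_solution_in_A: "(min_norm_solution A f, f) \<in> A"
    and min_norm_solution_orthogonal: "(n, 0) \<in> A \<Longrightarrow> ip (min_norm_solution A f) n = 0"
proof -
  obtain y0 where y0: "(y0, f) \<in> A" using assms by blast
  define N where "N = {n. (n, 0) \<in> A}"
  have N: "N = (\<lambda>n. (n, 0)) -` A" by (auto simp: N_def)
  have "linear (\<lambda>n :: 'a. (n, 0 :: 'a))" by (rule linearI) auto
  then have "subspace N" unfolding N by (rule linear_subspace_vimage[OF _ subspace_A])
  moreover have "closed N" unfolding N using closed by (auto intro!: closed_vimage continuous_intros)
  ultimately obtain p where p: "p \<in> N" "\<And>x. x \<in> N \<Longrightarrow> ip (y0 - p) x = 0"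
    using projection_exists[of N y0] by blast
  define y where "y = y0 - p"
  have y: "(y, f) \<in> A" using A_diff[OF y0, of p 0] p(1) by (simp add: N_def y_def)
  have orth: "ip y n = 0" if "(n, 0) \<in> A" for n using p(2) that by (simp add: N_def y_def)
  have pyth: "(norm u)\<^sup>2 = (norm y)\<^sup>2 + (norm (u - y))\<^sup>2" if "(u, f) \<in> A" for u
  proof -
    have "ip y (u - y) = 0" using orth A_diff[OF that y] by simp
    then show ?thesis using norm_add_sq[of y "u - y"] by simp
  qed
  have "min_norm_solution A f = y"
    unfolding min_norm_solution_def
  proof (rule the_equality)
    have "norm y \<le> norm u" if "(u, f) \<in> A" for u
      using pyth[OF that] zero_le_power2[of "norm (u - y)"] norm_ge_zero[of u]
      by (metis le_add_same_cancel1 power2_le_imp_le)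
    then show "is_arg_min norm (\<lambda>u. (u, f) \<in> A) y"
      unfolding is_arg_min_def using y by (auto simp: not_less)
  next
    fix u assume u: "is_arg_min norm (\<lambda>u. (u, f) \<in> A) u"
    then have uA: "(u, f) \<in> A" and "norm u \<le> norm y"
      using y unfolding is_arg_min_def by (auto simp: not_less)
    then have "(norm u)\<^sup>2 \<le> (norm y)\<^sup>2" by simp
    then show "u = y" using pyth[OF uA] by simp
  qed
  then show "(min_norm_solution A f, f) \<in> A" "(n, 0) \<in> A \<Longrightarrow> ip (min_norm_solution A f) n = 0"
    using y orth by auto
qed

lemma min_norm_solution_in_closure_Range_Adj:
  assumes "f \<in> Range A"
  shows "min_norm_solution A f \<in> closure (Range Adj)"
proof -
  let ?y = "min_norm_solution A f" and ?S = "closure (Range Adj)"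
  have "linear (snd :: 'a \<times> 'a \<Rightarrow> 'a)" by (rule linear_snd)
  then have "subspace (Range Adj)"
    unfolding Range_snd by (rule linear_subspace_image[OF _ subspace_Adj])
  then obtain p where p: "p \<in> ?S" "\<And>x. x \<in> ?S \<Longrightarrow> ip (?y - p) x = 0"
    using projection_exists[of ?S ?y] subspace_closure by blast
  define q where "q = ?y - p"
  \<comment> \<open>Here (T + I) x = q with w = A x. As q - x = A^* w is orthogonal to q, the
    identity |q - x|^2 = -|w|^2 forces x = q and A q = 0.\<close>
  obtain x w where xw: "(x, w) \<in> A" "(0 - w, 1 *\<^sub>R (x - q)) \<in> Adj"
    by (rule normal_equation_solvable[OF zero_less_one])
  then have w: "(w, q - x) \<in> Adj" using Adj_minus[of "- w" "x - q"] by simp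
  then have "ip q (q - x) = 0" using p(2) closure_subset unfolding q_def by blast
  then have "(norm (q - x))\<^sup>2 = - ip x (q - x)" by (simp add: self[symmetric] diff_left)
  then have "(norm (q - x))\<^sup>2 + (norm w)\<^sup>2 = 0"
    using adjoint_eq[OF xw(1) w] by (simp add: self)
  then have "q - x = 0" "w = 0" by (simp_all add: add_nonneg_eq_0_iff)
  then have "(q, 0) \<in> A" using xw(1) by simp
  then have "ip ?y q = 0" by (rule min_norm_solution_orthogonal[OF assms])
  moreover have "ip p q = 0" using p(2)[OF p(1)] by (simp add: q_def commute)
  ultimately have "(norm q)\<^sup>2 = 0" by (simp add: self[symmetric] q_def diff_left)
  then have "?y = p" by (simp add: q_def)
  with p(1) show ?thesis by simp
qed

text \<open>This replaces the usual weak compactness argument: \<open>\<parallel>u - y\<parallel>\<^sup>2 \<le> 2\<langle>y - u, y\<rangle>\<close> as soon as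
  \<open>\<parallel>u\<parallel> \<le> \<parallel>y\<parallel>\<close>, and with \<open>y\<close> approximated by \<open>A\<^sup>*v\<close> the right-hand side is close to
  \<open>2\<langle>f - Au, v\<rangle>\<close>.\<close>

lemma tendsto_min_norm_solution:
  fixes U W :: "'b \<Rightarrow> 'a"
  assumes f: "f \<in> Range A"
    and UW: "\<forall>\<^sub>F t in F. (U t, W t) \<in> A"
    and le: "\<forall>\<^sub>F t in F. norm (U t) \<le> norm (min_norm_solution A f)"
    and W: "(W \<longlongrightarrow> f) F"
  shows "((\<lambda>t. norm (U t - min_norm_solution A f)) \<longlongrightarrow> 0) F"
proof -
  define y where "y = min_norm_solution A f"
  have yA: "(y, f) \<in> A" unfolding y_def by (rule min_norm_solution_in_A[OF f])
  have "((\<lambda>t. U t - y) \<longlongrightarrow> 0) F"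
  proof (rule tendstoI)
    fix e :: real assume e: "e > 0"
    \<comment> \<open>Chosen so that \<open>4 * (norm y + 1) * \<epsilon>\<close> is half of
      \<open>e\<^sup>2\<close>; the summand 1 avoids division by zero when
      \<open>y = 0\<close>.\<close>
    define \<epsilon> where "\<epsilon> = e\<^sup>2 / (8 * (norm y + 1))"
    have ny: "norm y + 1 > 0" by (simp add: add_nonneg_pos)
    then have "\<epsilon> > 0" using e by (simp add: \<epsilon>_def)
    moreover have "y \<in> closure (Range Adj)"
      unfolding y_def by (rule min_norm_solution_in_closure_Range_Adj[OF f])
    ultimately obtain v z where vz: "(v, z) \<in> Adj" and z: "norm (y - z) < \<epsilon>"
      by (metis RangeE closure_approachable dist_commute dist_norm)
    have small: "4 * norm y * norm (y - z) \<le> e\<^sup>2 / 2"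
    proof -
      have "4 * norm y * norm (y - z) \<le> 4 * (norm y + 1) * \<epsilon>"
        using z by (intro mult_mono) auto
      also have "\<dots> = e\<^sup>2 / 2" unfolding \<epsilon>_def using ny by (simp add: field_simps)
      finally show ?thesis .
    qed
    have "((\<lambda>t. 2 * (norm (f - W t) * norm v)) \<longlongrightarrow> 2 * (norm (f - f) * norm v)) F"
      by (intro tendsto_intros W)
    then have "\<forall>\<^sub>F t in F. 2 * (norm (f - W t) * norm v) < e\<^sup>2 / 2"
      by (rule order_tendstoD(2)) (use e in simp)
    with UW le show "\<forall>\<^sub>F t in F. dist (U t - y) 0 < e"
    proof eventually_elim
      case (elim t)
      have "(norm (U t - y))\<^sup>2 \<le> 2 * ip (y - U t) y"
      proof -
        have "(norm (U t))\<^sup>2 \<le> (norm y)\<^sup>2" using elim(2) by (simp add: y_def)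
        then show ?thesis unfolding norm_diff_sq by (simp add: diff_left self)
      qed
      also have "ip (y - U t) y = ip (f - W t) v + ip (y - U t) (y - z)"
        using adjoint_eq[OF A_diff[OF yA elim(1)] vz] by (simp add: diff_right)
      also have "2 * \<dots> \<le> 2 * (norm (f - W t) * norm v) + 4 * norm y * norm (y - z)"
      proof -
        have "norm (y - U t) \<le> 2 * norm y"
          using norm_triangle_ineq4[of y "U t"] elim(2) by (simp add: y_def)
        then have "ip (y - U t) (y - z) \<le> 2 * norm y * norm (y - z)"
          using ip_le[of "y - U t" "y - z"] by (meson mult_right_mono norm_ge_zero order_trans)
        then show ?thesis using ip_le[of "f - W t" v] by (simp add: algebra_simps)
      qed
      also have "\<dots> < e\<^sup>2" using elim(3) small by linarith
      finally show ?case using e by (simp add: power_less_imp_less_base)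
    qed
  qed
  then show ?thesis unfolding y_def by (simp add: tendsto_norm_zero_iff)
qed

section \<open>Convergence for exact data, and for noisy data with an a priori parameter
  choice\<close>

lemma reg_tendsto_min_norm_solution:
  assumes "f \<in> Range A"
  shows "((\<lambda>\<alpha>. norm (reg \<alpha> f - min_norm_solution A f)) \<longlongrightarrow> 0) (at_right 0)"
proof -
  define y where "y = min_norm_solution A f"
  have yA: "(y, f) \<in> A" unfolding y_def by (rule min_norm_solution_in_A[OF assms])
  have pos: "\<forall>\<^sub>F \<alpha> in at_right 0. (0::real) < \<alpha>" by (rule eventually_at_right_less)
  \<comment> \<open>F(y) has no data term since A y = f. Dropping either summand on the left gives
    the norm bound or the decay of the residual.\<close>
  have F: "(norm (residual \<alpha> f))\<^sup>2 + \<alpha> * (norm (reg \<alpha> f))\<^sup>2 \<le> \<alpha> * (norm y)\<^sup>2" if "\<alpha> > 0" for \<alpha>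
    using functional_le[OF that yA, of f] by simp
  have reg_le: "norm (reg \<alpha> f) \<le> norm y" if "\<alpha> > 0" for \<alpha>
  proof -
    have "\<alpha> * (norm (reg \<alpha> f))\<^sup>2 \<le> \<alpha> * (norm y)\<^sup>2"
      using F[OF that] zero_le_power2[of "norm (residual \<alpha> f)"] by linarith
    then show ?thesis using that by simp
  qed
  have res_le: "norm (residual \<alpha> f) \<le> sqrt \<alpha> * norm y" if "\<alpha> > 0" for \<alpha>
  proof -
    have "0 \<le> \<alpha> * (norm (reg \<alpha> f))\<^sup>2" using that by simp
    then have "(norm (residual \<alpha> f))\<^sup>2 \<le> \<alpha> * (norm y)\<^sup>2" using F[OF that] by linarith
    then have "(norm (residual \<alpha> f))\<^sup>2 \<le> (sqrt \<alpha> * norm y)\<^sup>2"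
      using that by (simp add: power_mult_distrib)
    then show ?thesis by (rule power2_le_imp_le) (use that in simp)
  qed
  have "((\<lambda>\<alpha>. sqrt \<alpha> * norm y) \<longlongrightarrow> sqrt 0 * norm y) (at_right 0)"
    by (intro tendsto_intros)
  then have "((\<lambda>\<alpha>. residual \<alpha> f) \<longlongrightarrow> 0) (at_right 0)"
    by (intro Lim_null_comparison[OF eventually_mono[OF pos res_le]]) simp_all
  then have lim: "((\<lambda>\<alpha>. f - residual \<alpha> f) \<longlongrightarrow> f) (at_right 0)"
    using tendsto_diff[OF tendsto_const[of f]] by fastforce
  have "\<forall>\<^sub>F \<alpha> in at_right 0. (reg \<alpha> f, f - residual \<alpha> f) \<in> A"
    using pos by eventually_elim (rule reg_in_A)
  moreover have "\<forall>\<^sub>F \<alpha> in at_right 0. norm (reg \<alpha> f) \<le> norm (min_norm_solution A f)"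
    using pos unfolding y_def[symmetric] by eventually_elim (rule reg_le)
  ultimately show ?thesis by (rule tendsto_min_norm_solution[OF assms _ _ lim])
qed

text \<open>With \<alpha> = \<delta>, the propagated noise is at most \<delta> / sqrt \<delta> =
  sqrt \<delta>; the rest is the error for exact data.\<close>

lemma reg_noisy_tendsto_min_norm_solution:
  assumes f: "f \<in> Range A" and "\<delta>\<^sub>0 > 0"
    and noise: "\<And>\<delta>. \<delta> \<in> {0<..<\<delta>\<^sub>0} \<Longrightarrow> norm (g \<delta> - f) \<le> \<delta>"
  shows "((\<lambda>\<delta>. norm (reg \<delta> (g \<delta>) - min_norm_solution A f)) \<longlongrightarrow> 0) (at_right 0)"
proof (rule Lim_null_comparison)
  have "((\<lambda>\<delta>. sqrt \<delta> + norm (reg \<delta> f - min_norm_solution A f)) \<longlongrightarrow> sqrt 0 + 0) (at_right 0)"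
    by (intro tendsto_add tendsto_real_sqrt tendsto_ident_at reg_tendsto_min_norm_solution f)
  then show "((\<lambda>\<delta>. sqrt \<delta> + norm (reg \<delta> f - min_norm_solution A f)) \<longlongrightarrow> 0) (at_right 0)" by simp
next
  have "\<forall>\<^sub>F \<delta> in at_right 0. \<delta> \<in> {0<..<\<delta>\<^sub>0}" using assms(2) by (rule eventually_at_right_real)
  then show "\<forall>\<^sub>F \<delta> in at_right 0. norm (norm (reg \<delta> (g \<delta>) - min_norm_solution A f))
      \<le> sqrt \<delta> + norm (reg \<delta> f - min_norm_solution A f)"
  proof eventually_elim
    case (elim \<delta>)
    then have \<delta>: "\<delta> > 0" by simp
    have "norm (reg \<delta> (g \<delta>) - reg \<delta> f) \<le> norm (g \<delta> - f) / sqrt \<delta>"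
      using norm_reg_le[OF \<delta>, of "g \<delta> - f"] reg_diff[OF \<delta>] by simp
    also have "\<dots> \<le> \<delta> / sqrt \<delta>" using noise[OF elim] \<delta> by (simp add: divide_right_mono)
    also have "\<dots> = sqrt \<delta>" using \<delta> by (simp add: real_div_sqrt)
    finally show ?case
      using norm_triangle_ineq[of "reg \<delta> (g \<delta>) - reg \<delta> f" "reg \<delta> f - min_norm_solution A f"] by simp
  qed
qed

section \<open>The discrepancy as a function of \<alpha>\<close>

text \<open>Comparing F with its value at a solution \<open>y\<close> for the data \<open>f\<close>
  bounds the discrepancy for small \<alpha> by little more than the noise.\<close>

lemma norm_residual_le_of_solution:
  assumes "\<alpha> > 0" "(y, f) \<in> A"
  shows "(norm (residual \<alpha> g))\<^sup>2 \<le> (norm (g - f))\<^sup>2 + \<alpha> * (norm y)\<^sup>2"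
proof -
  have "0 \<le> \<alpha> * (norm (reg \<alpha> g))\<^sup>2" using assms(1) by simp
  then show ?thesis using functional_le[OF assms, of g] by (simp add: norm_minus_commute)
qed

text \<open>Each of the two minimizers is a competitor in the other's functional. The retained term
  in the difference of the minimizers is what later yields strictness.\<close>

lemma residual_increment:
  assumes "0 < \<alpha>" "\<alpha> < \<beta>"
  shows "(norm (residual \<alpha> g))\<^sup>2 + \<alpha> * (norm (reg \<beta> g - reg \<alpha> g))\<^sup>2 \<le> (norm (residual \<beta> g))\<^sup>2"
proof -
  let ?u = "reg \<alpha> g" and ?v = "reg \<beta> g" and ?r = "residual \<alpha> g" and ?s = "residual \<beta> g"
  have \<beta>: "0 < \<beta>" using assms by simp
  have 1: "(norm ?s)\<^sup>2 + \<alpha> * (norm ?v)\<^sup>2 =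
      (norm ?r)\<^sup>2 + \<alpha> * (norm ?u)\<^sup>2 + (norm (g - ?s - (g - ?r)))\<^sup>2 + \<alpha> * (norm (?v - ?u))\<^sup>2"
    using functional_expansion[OF assms(1) reg_in_A[OF \<beta>], of g g] by simp
  have 2: "(norm ?s)\<^sup>2 + \<beta> * (norm ?v)\<^sup>2 \<le> (norm ?r)\<^sup>2 + \<beta> * (norm ?u)\<^sup>2"
    using functional_le[OF \<beta> reg_in_A[OF assms(1)], of g g] by simp
  have 3: "0 \<le> \<alpha> * (norm (?v - ?u))\<^sup>2" "0 \<le> (norm (g - ?s - (g - ?r)))\<^sup>2" using assms by auto
  \<comment> \<open>Subtracting 1 from 2 cancels both residuals: the minimizer for the larger
    parameter has the smaller norm.\<close>
  have "(\<beta> - \<alpha>) * (norm ?v)\<^sup>2 \<le> (\<beta> - \<alpha>) * (norm ?u)\<^sup>2"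
    unfolding left_diff_distrib using 1 2 3 by linarith
  then have "(norm ?v)\<^sup>2 \<le> (norm ?u)\<^sup>2" using assms by simp
  then have "\<alpha> * (norm ?v)\<^sup>2 \<le> \<alpha> * (norm ?u)\<^sup>2" using assms by simp
  then show ?thesis using 1 3 by linarith
qed

lemma norm_residual_mono:
  assumes "0 < \<alpha>" "\<alpha> \<le> \<beta>"
  shows "norm (residual \<alpha> g) \<le> norm (residual \<beta> g)"
proof (cases "\<alpha> = \<beta>")
  case False
  then have "\<alpha> < \<beta>" using assms by simp
  from residual_increment[OF assms(1) this, of g] have "(norm (residual \<alpha> g))\<^sup>2 \<le> (norm (residual \<beta> g))\<^sup>2"
    using mult_nonneg_nonneg[of \<alpha> "(norm (reg \<beta> g - reg \<alpha> g))\<^sup>2"] assms(1) zero_le_power2[of "norm (reg \<beta> g - reg \<alpha> g)"]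
    by linarith
  then show ?thesis by simp
qed simp

text \<open>Equality forces a common minimizer u and a common residual r, so A^* r = \<alpha> u =
  \<beta> u. Hence u = 0, r = g and A^* g = 0, which is excluded.\<close>

lemma norm_residual_strict_mono:
  assumes "0 < \<alpha>" "\<alpha> < \<beta>" "(g, 0) \<notin> Adj"
  shows "norm (residual \<alpha> g) < norm (residual \<beta> g)"
proof (rule ccontr)
  let ?u = "reg \<alpha> g"
  assume "\<not> ?thesis"
  then have "(norm (residual \<beta> g))\<^sup>2 \<le> (norm (residual \<alpha> g))\<^sup>2" by simp
  then have "\<alpha> * (norm (reg \<beta> g - ?u))\<^sup>2 \<le> 0"
    using residual_increment[OF assms(1,2), of g] by linarith
  then have u: "reg \<beta> g = ?u" using assms(1) by (simp add: mult_le_0_iff)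
  then have r: "residual \<beta> g = residual \<alpha> g" by (simp add: residual_def)
  have "\<alpha> *\<^sub>R ?u = \<beta> *\<^sub>R ?u"
    using residual_in_Adj[of \<alpha> g] residual_in_Adj[of \<beta> g] assms u r
    by (intro Adj_unique[of "residual \<alpha> g"]) simp_all
  then have "?u = 0" using assms(2) by simp
  then have "residual \<alpha> g = g" "(residual \<alpha> g, 0) \<in> Adj"
    using residual_in_Adj[OF assms(1), of g] by (simp_all add: residual_def apply_op_A[OF A_zero])
  then show False using assms(3) by simp
qed

text \<open>A zero residual would give \<alpha> u = A^* 0 = 0, and then the residual would be
  \<open>g\<close> itself.\<close>

lemma residual_pos:
  assumes "\<alpha> > 0" "g \<noteq> 0"
  shows "norm (residual \<alpha> g) > 0"
proof (rule ccontr)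
  assume "\<not> ?thesis"
  then have r: "residual \<alpha> g = 0" by simp
  have "(0, 0) \<in> Adj" using subspace_0[OF subspace_Adj] by (simp add: zero_prod_def)
  then have "\<alpha> *\<^sub>R reg \<alpha> g = 0" using residual_in_Adj[OF assms(1), of g] r Adj_unique by metis
  then have "reg \<alpha> g = 0" using assms(1) by simp
  then show False using r assms(2) by (simp add: residual_def apply_op_A[OF A_zero])
qed

text \<open>Subtracting the normal equations for \<alpha> and \<beta> and pairing as in the
  uniqueness proof leaves one extra term, with factor \<alpha> - \<beta>.\<close>

lemma residual_lipschitz:
  assumes "\<alpha> > 0" "\<beta> > 0"
  shows "norm (residual \<alpha> g - residual \<beta> g) \<le> \<bar>\<alpha> - \<beta>\<bar> * (norm (reg \<beta> g) / sqrt \<alpha>)"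
proof -
  let ?r = "residual \<alpha> g" and ?s = "residual \<beta> g" and ?u = "reg \<alpha> g" and ?v = "reg \<beta> g"
  \<comment> \<open>The extra term is at most a b, and \<open>a\<^sup>2\<close> already stands on
    the left, so a b \<le> a^2 + b^2 absorbs the unknown difference of the minimizers.\<close>
  define a where "a = sqrt \<alpha> * norm (?u - ?v)"
  define b where "b = \<bar>\<alpha> - \<beta>\<bar> * (norm ?v / sqrt \<alpha>)"
  have b: "b \<ge> 0" using assms by (simp add: b_def)
  have "(?u - ?v, (g - ?r) - (g - ?s)) \<in> A" using assms by (intro A_diff reg_in_A)
  moreover have "(?r - ?s, \<alpha> *\<^sub>R ?u - \<beta> *\<^sub>R ?v) \<in> Adj" using assms by (intro Adj_diff residual_in_Adj)
  ultimately have "ip ((g - ?r) - (g - ?s)) (?r - ?s) = ip (?u - ?v) (\<alpha> *\<^sub>R ?u - \<beta> *\<^sub>R ?v)"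
    by (rule adjoint_eq)
  moreover have "(g - ?r) - (g - ?s) = - (?r - ?s)" by simp
  moreover have "\<alpha> *\<^sub>R ?u - \<beta> *\<^sub>R ?v = \<alpha> *\<^sub>R (?u - ?v) + (\<alpha> - \<beta>) *\<^sub>R ?v" by (simp add: algebra_simps)
  ultimately have eq: "(norm (?r - ?s))\<^sup>2 + \<alpha> * (norm (?u - ?v))\<^sup>2 = - ((\<alpha> - \<beta>) * ip (?u - ?v) ?v)"
    by (simp only: minus_left add_right scaleR_right self)
  also have "\<dots> \<le> \<bar>\<alpha> - \<beta>\<bar> * (norm (?u - ?v) * norm ?v)"
  proof -
    have "- ((\<alpha> - \<beta>) * ip (?u - ?v) ?v) \<le> \<bar>\<alpha> - \<beta>\<bar> * \<bar>ip (?u - ?v) ?v\<bar>"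
      by (metis abs_ge_minus_self abs_mult)
    also have "\<dots> \<le> \<bar>\<alpha> - \<beta>\<bar> * (norm (?u - ?v) * norm ?v)"
      by (intro mult_left_mono Cauchy_Schwarz) simp
    finally show ?thesis .
  qed
  also have "\<dots> = a * b" using assms(1) by (simp add: a_def b_def)
  finally have "(norm (?r - ?s))\<^sup>2 + a\<^sup>2 \<le> a * b"
    using assms(1) by (simp add: a_def power_mult_distrib)
  moreover have "a * b \<le> a\<^sup>2 + b\<^sup>2"
    using sum_squares_bound[of a b] zero_le_power2[of a] zero_le_power2[of b] by linarith
  ultimately have "(norm (?r - ?s))\<^sup>2 \<le> b\<^sup>2" by linarith
  then show ?thesis using b unfolding b_def[symmetric] by (rule power2_le_imp_le)
qed

lemma isCont_norm_residual:
  assumes "\<beta> > 0"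
  shows "isCont (\<lambda>\<alpha>. norm (residual \<alpha> g)) \<beta>"
proof -
  have "((\<lambda>\<alpha>. \<bar>\<alpha> - \<beta>\<bar> * (norm (reg \<beta> g) / sqrt \<alpha>)) \<longlongrightarrow> \<bar>\<beta> - \<beta>\<bar> * (norm (reg \<beta> g) / sqrt \<beta>)) (at \<beta>)"
    using assms by (intro tendsto_intros) auto
  then have 1: "((\<lambda>\<alpha>. \<bar>\<alpha> - \<beta>\<bar> * (norm (reg \<beta> g) / sqrt \<alpha>)) \<longlongrightarrow> 0) (at \<beta>)" by simp
  have "\<forall>\<^sub>F \<alpha> in at \<beta>. 0 < \<alpha>"
    using order_tendstoD(1)[OF tendsto_ident_at assms] .
  then have "\<forall>\<^sub>F \<alpha> in at \<beta>. norm (residual \<alpha> g - residual \<beta> g) \<le> \<bar>\<alpha> - \<beta>\<bar> * (norm (reg \<beta> g) / sqrt \<alpha>)"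
    by eventually_elim (rule residual_lipschitz[OF _ assms])
  then have "((\<lambda>\<alpha>. residual \<alpha> g - residual \<beta> g) \<longlongrightarrow> 0) (at \<beta>)"
    by (rule Lim_null_comparison[OF _ 1])
  then show ?thesis unfolding isCont_def by (intro tendsto_norm) (simp add: LIM_zero_iff)
qed

lemma norm_residual_exceeds:
  assumes "c < norm g"
  obtains \<alpha> where "\<alpha> > 0" "c < norm (residual \<alpha> g)"
proof -
  define e where "e = (norm g - c) / 3"
  have e: "e > 0" using assms by (simp add: e_def)
  have "g \<in> closure (Domain Adj)" using dense_Domain_Adj by simp
  then obtain g' z where g': "(g', z) \<in> Adj" and d: "norm (g - g') < e"
    using e by (metis DomainE closure_approachable dist_commute dist_norm)
  \<comment> \<open>Ensures |z|^2 \<le> \<alpha> e^2; the summand 1 keeps \<alpha> positive when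
    \<open>z = 0\<close>.\<close>
  define \<alpha> where "\<alpha> = (norm z / e)\<^sup>2 + 1"
  have \<alpha>: "\<alpha> > 0" by (simp add: \<alpha>_def add_nonneg_pos)
  let ?r = "residual \<alpha> g'" and ?u = "reg \<alpha> g'"
  have "(g' - ?r, z - \<alpha> *\<^sub>R ?u) \<in> Adj" by (rule Adj_diff[OF g' residual_in_Adj[OF \<alpha>]])
  then have "ip (g' - ?r) (g' - ?r) = ip ?u (z - \<alpha> *\<^sub>R ?u)"
    by (rule adjoint_eq[OF reg_in_A[OF \<alpha>]])
  then have eq: "(norm (g' - ?r))\<^sup>2 = ip ?u z - \<alpha> * (norm ?u)\<^sup>2"
    by (simp add: self diff_right scaleR_right)
  have "norm (g' - ?r) \<le> e"
  proof -
    have "4 * \<alpha> * (ip ?u z - \<alpha> * (norm ?u)\<^sup>2) \<le> (norm z)\<^sup>2"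
    proof -
      \<comment> \<open>Completing the square: <u, z> - \<alpha> |u|^2 is largest at 2 \<alpha> u =
        z.\<close>
      have "0 \<le> (norm (z - (2 * \<alpha>) *\<^sub>R ?u))\<^sup>2" by simp
      then show ?thesis unfolding norm_diff_sq
        by (simp add: scaleR_right commute[of z] power_mult_distrib) (simp add: algebra_simps power2_eq_square)
    qed
    then have "4 * \<alpha> * (norm (g' - ?r))\<^sup>2 \<le> (norm z)\<^sup>2" by (simp add: eq)
    moreover have "(norm z)\<^sup>2 \<le> \<alpha> * e\<^sup>2"
      using e by (simp add: \<alpha>_def field_simps power_divide)
    moreover have "0 \<le> \<alpha> * (norm (g' - ?r))\<^sup>2" using \<alpha> by simp
    ultimately have "\<alpha> * (norm (g' - ?r))\<^sup>2 \<le> \<alpha> * e\<^sup>2" by linarith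
    then have "(norm (g' - ?r))\<^sup>2 \<le> e\<^sup>2" using \<alpha> by simp
    then show ?thesis by (rule power2_le_imp_le) (use e in simp)
  qed
  moreover have "norm (residual \<alpha> g - ?r) < e"
    using norm_residual_le[OF \<alpha>, of "g - g'"] d by (simp add: residual_diff[OF \<alpha>])
  moreover have "norm g \<le> norm (g - g') + norm (g' - ?r) + norm (residual \<alpha> g - ?r) + norm (residual \<alpha> g)"
    using norm_triangle_ineq[of "g - g'" g'] norm_triangle_ineq[of "g' - ?r" ?r]
      norm_triangle_ineq4[of "residual \<alpha> g" "residual \<alpha> g - ?r"] by simp
  ultimately have "norm g < 3 * e + norm (residual \<alpha> g)" using d by linarith
  then have "c < norm (residual \<alpha> g)" by (simp add: e_def field_simps)
  with \<alpha> show ?thesis by (rule that)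
qed

section \<open>The discrepancy principle: unique parameter and convergence\<close>

lemma discrepancy_principle_ex1:
  assumes "f \<in> Range A" "C > 1" "\<delta> > 0" "norm (g - f) \<le> \<delta>" "norm g > C * \<delta>"
  shows "\<exists>!\<alpha>. \<alpha> > 0 \<and> norm (residual \<alpha> g) = C * \<delta>"
proof -
  obtain y where y: "(y, f) \<in> A" using assms(1) by blast
  have less: "\<delta> < C * \<delta>" using assms by simp
  have "(g, 0) \<notin> Adj"
  proof
    assume "(g, 0) \<in> Adj"
    then have "ip f g = 0" using adjoint_eq[OF y] by (simp add: zero_right)
    then have "(norm (g - f))\<^sup>2 = (norm g)\<^sup>2 + (norm f)\<^sup>2" unfolding norm_diff_sq by (simp add: commute)
    then have "(norm g)\<^sup>2 \<le> (norm (g - f))\<^sup>2" by simp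
    then have "norm g \<le> norm (g - f)" by simp
    then show False using assms less by linarith
  qed
  then have strict: "norm (residual \<alpha> g) < norm (residual \<beta> g)" if "0 < \<alpha>" "\<alpha> < \<beta>" for \<alpha> \<beta>
    using that norm_residual_strict_mono by blast
  \<comment> \<open>Lower end of the bracket, solving \<delta>^2 + a (|y|^2 + 1) = (C \<delta>)^2;
    the summand 1 keeps the denominator positive when \<open>y = 0\<close>.\<close>
  define a where "a = ((C * \<delta>)\<^sup>2 - \<delta>\<^sup>2) / ((norm y)\<^sup>2 + 1)"
  have ny: "(norm y)\<^sup>2 + 1 > 0" by (simp add: add_nonneg_pos)
  have "\<delta>\<^sup>2 < (C * \<delta>)\<^sup>2" using less assms(3) by (intro power_strict_mono) auto
  then have a: "a > 0" using ny by (simp add: a_def)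
  have low: "norm (residual a g) \<le> C * \<delta>"
  proof -
    have "(norm (residual a g))\<^sup>2 \<le> (norm (g - f))\<^sup>2 + a * (norm y)\<^sup>2"
      by (rule norm_residual_le_of_solution[OF a y])
    also have "\<dots> \<le> \<delta>\<^sup>2 + a * ((norm y)\<^sup>2 + 1)"
      using a assms(4) by (intro add_mono power_mono mult_left_mono) auto
    also have "\<dots> = (C * \<delta>)\<^sup>2" using ny by (simp add: a_def)
    finally show ?thesis by (rule power2_le_imp_le) (use assms in simp)
  qed
  obtain b where b: "b > 0" "C * \<delta> < norm (residual b g)"
    using norm_residual_exceeds[OF assms(5)] by blast
  have "a \<le> b" using norm_residual_mono[OF b(1), of a g] low b(2) by linarith
  then obtain x where x: "a \<le> x" "norm (residual x g) = C * \<delta>"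
    using IVT[of "\<lambda>\<alpha>. norm (residual \<alpha> g)" a "C * \<delta>" b] low b(2) a isCont_norm_residual by force
  show ?thesis
  proof (rule ex1I[of _ x])
    show "x > 0 \<and> norm (residual x g) = C * \<delta>" using x a by simp
    show "\<beta> = x" if "\<beta> > 0 \<and> norm (residual \<beta> g) = C * \<delta>" for \<beta>
      using that strict[of \<beta> x] strict[of x \<beta>] x a by (cases \<beta> x rule: linorder_cases) auto
  qed
qed

context
  fixes f :: 'a and C \<delta>\<^sub>0 :: real and g :: "real \<Rightarrow> 'a" and \<alpha> :: "real \<Rightarrow> real"
  assumes f: "f \<in> Range A" "f \<noteq> 0" and C: "C > 1" and \<delta>\<^sub>0: "\<delta>\<^sub>0 > 0"
    and noise: "\<And>\<delta>. \<delta> \<in> {0<..<\<delta>\<^sub>0} \<Longrightarrow> norm (g \<delta> - f) \<le> \<delta>"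
    and \<alpha>_pos: "\<And>\<delta>. \<delta> \<in> {0<..<\<delta>\<^sub>0} \<Longrightarrow> \<alpha> \<delta> > 0"
    and discrepancy: "\<And>\<delta>. \<delta> \<in> {0<..<\<delta>\<^sub>0} \<Longrightarrow> norm (residual (\<alpha> \<delta>) (g \<delta>)) = C * \<delta>"
begin

lemma eventually_noise_range: "\<forall>\<^sub>F \<delta> in at_right 0. \<delta> \<in> {0<..<\<delta>\<^sub>0}"
  using \<delta>\<^sub>0 by (rule eventually_at_right_real)

text \<open>At the chosen parameter the residual of the exact data is at most (C + 1) \<delta>,
  whereas at a fixed parameter \<open>e\<close> it is a positive constant. Monotonicity then forces
  the chosen parameter below \<open>e\<close>.\<close>

lemma discrepancy_parameter_tendsto_0: "(\<alpha> \<longlongrightarrow> 0) (at_right 0)"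
proof (rule tendstoI)
  fix e :: real assume e: "e > 0"
  have "((\<lambda>\<delta>. (C + 1) * \<delta>) \<longlongrightarrow> (C + 1) * 0) (at_right 0)" by (intro tendsto_intros)
  then have "\<forall>\<^sub>F \<delta> in at_right 0. (C + 1) * \<delta> < norm (residual e f)"
    by (rule order_tendstoD(2)) (use residual_pos[OF e f(2)] in simp)
  with eventually_noise_range show "\<forall>\<^sub>F \<delta> in at_right 0. dist (\<alpha> \<delta>) 0 < e"
  proof eventually_elim
    case (elim \<delta>)
    have pos: "\<alpha> \<delta> > 0" using \<alpha>_pos elim(1) .
    have "norm (residual (\<alpha> \<delta>) (g \<delta>) - residual (\<alpha> \<delta>) f) \<le> \<delta>"
      using norm_residual_le[OF pos, of "g \<delta> - f"] noise[OF elim(1)] by (simp add: residual_diff[OF pos])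
    then have "norm (residual (\<alpha> \<delta>) f) \<le> (C + 1) * \<delta>"
      using norm_triangle_sub[of "residual (\<alpha> \<delta>) f" "residual (\<alpha> \<delta>) (g \<delta>)"] discrepancy[OF elim(1)]
      by (simp add: norm_minus_commute algebra_simps)
    then have "\<not> e \<le> \<alpha> \<delta>" using norm_residual_mono[OF e, of "\<alpha> \<delta>" f] elim(2) by linarith
    then show ?case using pos by simp
  qed
qed

text \<open>In F(u) \<le> F(y) the data term of u is exactly (C \<delta>)^2 and that of y is at most
  as large; cancelling leaves |u| \<le> |y|. The discrepancy equation also gives A u -> f.\<close>

lemma discrepancy_reg_tendsto:
  "((\<lambda>\<delta>. norm (reg (\<alpha> \<delta>) (g \<delta>) - min_norm_solution A f)) \<longlongrightarrow> 0) (at_right 0)"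
proof (rule tendsto_min_norm_solution[OF f(1)])
  show "\<forall>\<^sub>F \<delta> in at_right 0. (reg (\<alpha> \<delta>) (g \<delta>), g \<delta> - residual (\<alpha> \<delta>) (g \<delta>)) \<in> A"
    using eventually_noise_range by eventually_elim (rule reg_in_A[OF \<alpha>_pos])
next
  show "\<forall>\<^sub>F \<delta> in at_right 0. norm (reg (\<alpha> \<delta>) (g \<delta>)) \<le> norm (min_norm_solution A f)"
    using eventually_noise_range
  proof eventually_elim
    case (elim \<delta>)
    have pos: "\<alpha> \<delta> > 0" using \<alpha>_pos elim .
    have "(norm (f - g \<delta>))\<^sup>2 \<le> (C * \<delta>)\<^sup>2"
    proof (rule power_mono)
      have "\<delta> \<le> C * \<delta>" using C elim by simp
      then show "norm (f - g \<delta>) \<le> C * \<delta>" using noise[OF elim] by (simp add: norm_minus_commute)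
    qed simp
    then have "\<alpha> \<delta> * (norm (reg (\<alpha> \<delta>) (g \<delta>)))\<^sup>2 \<le> \<alpha> \<delta> * (norm (min_norm_solution A f))\<^sup>2"
      using functional_le[OF pos min_norm_solution_in_A[OF f(1)], of "g \<delta>"] discrepancy[OF elim] by simp
    then show ?case using pos by simp
  qed
next
  have "((\<lambda>\<delta>. (C + 1) * \<delta>) \<longlongrightarrow> (C + 1) * 0) (at_right 0)" by (intro tendsto_intros)
  then have 1: "((\<lambda>\<delta>. (C + 1) * \<delta>) \<longlongrightarrow> 0) (at_right 0)" by simp
  have "\<forall>\<^sub>F \<delta> in at_right 0. norm (g \<delta> - residual (\<alpha> \<delta>) (g \<delta>) - f) \<le> (C + 1) * \<delta>"
    using eventually_noise_range
  proof eventually_elim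
    case (elim \<delta>)
    show ?case
      using norm_triangle_ineq4[of "g \<delta> - f" "residual (\<alpha> \<delta>) (g \<delta>)"] noise[OF elim] discrepancy[OF elim]
      by (simp add: algebra_simps)
  qed
  then have "((\<lambda>\<delta>. g \<delta> - residual (\<alpha> \<delta>) (g \<delta>) - f) \<longlongrightarrow> 0) (at_right 0)"
    by (rule Lim_null_comparison[OF _ 1])
  then show "((\<lambda>\<delta>. g \<delta> - residual (\<alpha> \<delta>) (g \<delta>)) \<longlongrightarrow> f) (at_right 0)" by (simp add: LIM_zero_iff)
qed

end

end

section \<open>Reduction of the scalar field to the reals\<close>

lemma conjugate_of_real: "conjugate (of_real r :: 'k::real_or_complex) = of_real r"
proof (cases "r = 0")
  case True
  have "conjugate (0 :: 'k) + conjugate 0 = conjugate 0" using conjugate_add[of 0 "0 :: 'k"] by simp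
  then show ?thesis using True by simp
next
  case False
  have "of_real r * conjugate (of_real r :: 'k) = of_real r * of_real r"
    unfolding mult_conjugate by (simp add: scaleR_conv_of_real power2_eq_square)
  then show ?thesis using False by simp
qed

context hilbert_space
begin

text \<open>The real part of \<^term>\<open>ip x y\<close>, recovered from the norm since the scalar field is abstract.\<close>

definition real_ip :: "'a \<Rightarrow> 'a \<Rightarrow> real" where
  "real_ip x y = ((norm (x + y))\<^sup>2 - (norm x)\<^sup>2 - (norm y)\<^sup>2) / 2"

lemma ip_add_right: "ip z (x + y) = ip z x + ip z y"
  by (metis conjugate_add ip_add_left ip_commute)

lemma of_real_real_ip: "of_real (2 * real_ip x y) = ip x y + conjugate (ip x y)"
proof -
  have "ip (x + y) (x + y) = ip x x + ip x y + (ip y x + ip y y)"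
    by (simp add: ip_add_left ip_add_right)
  then have "of_real ((norm (x + y))\<^sup>2) = of_real ((norm x)\<^sup>2) + of_real ((norm y)\<^sup>2) + (ip x y + ip y x)"
    unfolding ip_self by simp
  then show ?thesis
    unfolding real_ip_def ip_commute[of y x, symmetric] by simp
qed

lemma real_ip_eqI: "of_real (2 * r) = ip x y + conjugate (ip x y) \<Longrightarrow> real_ip x y = r"
  unfolding of_real_real_ip[symmetric] of_real_eq_iff by simp

lemma real_inner_product_real_ip: "real_inner_product real_ip"
proof
  fix x y z :: 'a and r :: real
  show "real_ip x y = real_ip y x" by (simp add: real_ip_def add.commute)
  show "real_ip (x + y) z = real_ip x z + real_ip y z"
    by (rule real_ip_eqI)
      (simp add: distrib_left of_real_real_ip ip_add_left conjugate_add del: of_real_mult)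
  show "real_ip (r *\<^sub>R x) y = r * real_ip x y"
  proof (rule real_ip_eqI)
    have "of_real (2 * (r * real_ip x y)) = of_real r * (ip x y + conjugate (ip x y))"
      unfolding of_real_real_ip[symmetric] by simp
    then show "of_real (2 * (r * real_ip x y)) = ip (r *\<^sub>R x) y + conjugate (ip (r *\<^sub>R x) y)"
      unfolding scale_of_real[symmetric] ip_scale_left conjugate_mult conjugate_of_real
      by (simp add: distrib_left)
  qed
  show "real_ip x x = (norm x)\<^sup>2"
    by (rule real_ip_eqI) (simp only: ip_self conjugate_of_real of_real_add[symmetric] mult_2)
qed

text \<open>D(A) is closed under scalars, so a defect d = <w, y> - <x, z> can be rotated: scaling x
  and w by the conjugate of d turns it into the real number |d|^2, which equality of real parts
  makes zero.\<close>

lemma adjoint_op_real_ip: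
  assumes "linear_operator sc A"
  shows "adjoint_op real_ip A = adjoint_op ip A"
proof -
  have "ip w y = ip x z" if adj: "\<And>x w. (x, w) \<in> A \<Longrightarrow> real_ip w y = real_ip x z" and xw: "(x, w) \<in> A"
    for x w y z
  proof -
    define d where "d = ip w y - ip x z"
    define c where "c = conjugate d"
    have "(sc c x, sc c w) \<in> A" using assms xw by (auto simp: linear_operator_def)
    then have eq: "real_ip (sc c w) y = real_ip (sc c x) z" by (rule adj)
    have cd: "c * ip w y - c * ip x z = of_real ((norm d)\<^sup>2)"
      using mult_conjugate[of d] unfolding c_def d_def
      by (simp add: algebra_simps scaleR_conv_of_real)
    have "ip (sc c w) y + conjugate (ip (sc c w) y) = ip (sc c x) z + conjugate (ip (sc c x) z)"
      unfolding of_real_real_ip[symmetric] eq ..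
    moreover have "ip (sc c w) y = ip (sc c x) z + of_real ((norm d)\<^sup>2)"
      using cd by (simp add: ip_scale_left algebra_simps)
    ultimately have "of_real ((norm d)\<^sup>2) + of_real ((norm d)\<^sup>2) = (0 :: 'k)"
      by (simp add: conjugate_add conjugate_of_real del: of_real_power)
    then have "of_real (2 * (norm d)\<^sup>2) = (0 :: 'k)" by simp
    then have "d = 0" unfolding of_real_eq_0_iff by simp
    then show ?thesis by (simp add: d_def)
  qed
  moreover have "real_ip w y = real_ip x z" if "ip w y = ip x z" for w y x z
    by (rule real_ip_eqI) (simp only: of_real_real_ip that)
  ultimately show ?thesis unfolding adjoint_op_def by fast
qed

end

theorem theorem2:
  fixes sc :: "'k::real_or_complex \<Rightarrow> 'a::banach \<Rightarrow> 'a"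
    and ip :: "'a \<Rightarrow> 'a \<Rightarrow> 'k"
    and A :: "('a \<times> 'a) set"
  assumes "hilbert_space sc ip"
    and "linear_operator sc A"
    and "closed A"
    and "closure (Domain A) = UNIV"
    and "\<not> bounded_op A"
    and "\<not> boundedly_invertible A"
  shows
    "(\<forall>f. \<forall>\<alpha>>0.
        everywhere_defined ((T_shift ip A \<alpha>)\<inverse>) \<and>
        everywhere_defined ((Q_shift ip A \<alpha>)\<inverse>) \<and>
        everywhere_defined (reg_op ip A \<alpha>) \<and>
        everywhere_defined (reg_op' ip A \<alpha>) \<and>
        (\<exists>!u. global_minimizer A f \<alpha> u) \<and>
        global_minimizer A f \<alpha> (apply_op (reg_op ip A \<alpha>) f) \<and>
        apply_op (reg_op ip A \<alpha>) f = apply_op (reg_op' ip A \<alpha>) f)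
     \<and>
     (\<forall>f \<in> Range A.
        ((\<lambda>\<alpha>. norm ((THE u. global_minimizer A f \<alpha> u) - min_norm_solution A f)) \<longlongrightarrow> 0)
          (at_right 0))
     \<and>
     (\<forall>f \<in> Range A. \<forall>\<delta>\<^sub>0 > 0. \<forall>f\<^sub>\<delta> :: real \<Rightarrow> 'a.
        f \<noteq> 0 \<longrightarrow> (\<forall>\<delta> \<in> {0<..<\<delta>\<^sub>0}. norm (f\<^sub>\<delta> \<delta> - f) \<le> \<delta>) \<longrightarrow>
        (\<exists>\<alpha> :: real \<Rightarrow> real.
           (\<forall>\<delta> \<in> {0<..<\<delta>\<^sub>0}. \<alpha> \<delta> > 0) \<and>
           (\<alpha> \<longlongrightarrow> 0) (at_right 0) \<and>
           ((\<lambda>\<delta>. norm (apply_op (reg_op ip A (\<alpha> \<delta>)) (f\<^sub>\<delta> \<delta>) - min_norm_solution A f)) \<longlongrightarrow> 0)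
             (at_right 0)))
     \<and>
     (\<forall>f \<in> Range A. \<forall>\<delta>\<^sub>0 > 0. \<forall>f\<^sub>\<delta> :: real \<Rightarrow> 'a. \<forall>C > 1.
        f \<noteq> 0 \<longrightarrow> (\<forall>\<delta> \<in> {0<..<\<delta>\<^sub>0}. norm (f\<^sub>\<delta> \<delta> - f) \<le> \<delta>) \<longrightarrow>
        (\<forall>\<delta> \<in> {0<..<\<delta>\<^sub>0}. norm (f\<^sub>\<delta> \<delta>) > C * \<delta>) \<longrightarrow>
        (\<forall>\<delta> \<in> {0<..<\<delta>\<^sub>0}. \<exists>!\<alpha>. \<alpha> > 0 \<and>
           norm (apply_op A (apply_op (reg_op ip A \<alpha>) (f\<^sub>\<delta> \<delta>)) - f\<^sub>\<delta> \<delta>) = C * \<delta>) \<and>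
        (\<forall>\<alpha> :: real \<Rightarrow> real.
           (\<forall>\<delta> \<in> {0<..<\<delta>\<^sub>0}. \<alpha> \<delta> > 0 \<and>
              norm (apply_op A (apply_op (reg_op ip A (\<alpha> \<delta>)) (f\<^sub>\<delta> \<delta>)) - f\<^sub>\<delta> \<delta>) = C * \<delta>) \<longrightarrow>
           (\<alpha> \<longlongrightarrow> 0) (at_right 0) \<and>
           ((\<lambda>\<delta>. norm (apply_op (reg_op ip A (\<alpha> \<delta>)) (f\<^sub>\<delta> \<delta>) - min_norm_solution A f)) \<longlongrightarrow> 0)
             (at_right 0)))"
proof -
  interpret H: hilbert_space sc ip by fact
  \<comment> \<open>Real scaling is \<open>sc\<close> applied to embedded reals, so linearity over
    the field restricts to real linearity.\<close>
  have "linear_operator (*\<^sub>R) A"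
    using assms(2) H.scale_of_real unfolding linear_operator_def by metis
  then interpret closed_dense_operator H.real_ip A
    using H.real_inner_product_real_ip assms(3,4)
    by (simp add: closed_dense_operator_def closed_dense_operator_axioms_def)
  note adj = H.adjoint_op_real_ip[OF assms(2), symmetric]
  have T: "T_shift ip A = T_shift H.real_ip A"
    by (intro ext) (simp add: T_shift_def adj)
  have Q: "Q_shift ip A = Q_shift H.real_ip A"
    by (intro ext) (simp add: Q_shift_def adj)
  have R: "reg_op ip A = reg_op H.real_ip A"
    by (intro ext) (simp add: reg_op_def Q adj)
  have R': "reg_op' ip A = reg_op' H.real_ip A"
    by (intro ext) (simp add: reg_op'_def T adj)
  have residual: "norm (apply_op A (reg \<alpha> g) - g) = norm (residual \<alpha> g)" for \<alpha> g
    by (simp add: residual_def norm_minus_commute)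
  show ?thesis
    unfolding T Q R R' reg_def[symmetric] residual
  proof (intro conjI allI ballI impI)
    fix f :: 'a and \<alpha> :: real assume \<alpha>: "\<alpha> > 0"
    show "everywhere_defined ((T_shift H.real_ip A \<alpha>)\<inverse>)"
      by (rule everywhere_defined_T_shift_inverse[OF \<alpha>])
    show "everywhere_defined ((Q_shift H.real_ip A \<alpha>)\<inverse>)"
      by (rule everywhere_defined_Q_shift_inverse[OF \<alpha>])
    show "everywhere_defined (reg_op H.real_ip A \<alpha>)"
      by (rule everywhere_defined_reg_op[OF \<alpha>])
    then show "everywhere_defined (reg_op' H.real_ip A \<alpha>)" by (simp only: reg_op'_eq[OF \<alpha>])
    show "\<exists>!u. global_minimizer A f \<alpha> u" by (simp add: global_minimizer_iff[OF \<alpha>])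
    show "global_minimizer A f \<alpha> (reg \<alpha> f)" by (simp add: global_minimizer_iff[OF \<alpha>])
    show "reg \<alpha> f = apply_op (reg_op' H.real_ip A \<alpha>) f" by (simp only: reg_op'_eq[OF \<alpha>] reg_def)
  next
    fix f assume f: "f \<in> Range A"
    \<comment> \<open>The described minimizer is identified with \<open>reg \<alpha> f\<close> only
      for positive \<alpha>, which suffices for a limit from the right.\<close>
    have "\<forall>\<^sub>F \<alpha> in at_right 0. norm (reg \<alpha> f - min_norm_solution A f) =
        norm ((THE u. global_minimizer A f \<alpha> u) - min_norm_solution A f)"
      using eventually_at_right_less[of "0::real"] by eventually_elim (simp add: global_minimizer_iff)
    then show "((\<lambda>\<alpha>. norm ((THE u. global_minimizer A f \<alpha> u) - min_norm_solution A f)) \<longlongrightarrow> 0) (at_right 0)"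
      using reg_tendsto_min_norm_solution[OF f] by (rule Lim_transform_eventually[rotated])
  next
    fix f g and \<delta>\<^sub>0 :: real
    assume f: "f \<in> Range A" and \<delta>\<^sub>0: "0 < \<delta>\<^sub>0"
      and noise: "\<forall>\<delta>\<in>{0<..<\<delta>\<^sub>0}. norm (g \<delta> - f) \<le> \<delta>"
    have "((\<lambda>\<delta>. norm (reg \<delta> (g \<delta>) - min_norm_solution A f)) \<longlongrightarrow> 0) (at_right 0)"
      using noise by (intro reg_noisy_tendsto_min_norm_solution[OF f \<delta>\<^sub>0]) auto
    then show "\<exists>\<alpha>. (\<forall>\<delta>\<in>{0<..<\<delta>\<^sub>0}. 0 < \<alpha> \<delta>) \<and> (\<alpha> \<longlongrightarrow> 0) (at_right 0) \<and>
        ((\<lambda>\<delta>. norm (reg (\<alpha> \<delta>) (g \<delta>) - min_norm_solution A f)) \<longlongrightarrow> 0) (at_right 0)"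
      by (intro exI[of _ "\<lambda>\<delta>. \<delta>"]) auto
  next
    fix f g and \<delta>\<^sub>0 C \<delta> :: real
    assume "f \<in> Range A" "1 < C" "\<forall>\<delta>\<in>{0<..<\<delta>\<^sub>0}. norm (g \<delta> - f) \<le> \<delta>"
      "\<forall>\<delta>\<in>{0<..<\<delta>\<^sub>0}. C * \<delta> < norm (g \<delta>)" "\<delta> \<in> {0<..<\<delta>\<^sub>0}"
    then show "\<exists>!\<alpha>. 0 < \<alpha> \<and> norm (residual \<alpha> (g \<delta>)) = C * \<delta>"
      by (intro discrepancy_principle_ex1[of f]) auto
  next
    fix f g and \<delta>\<^sub>0 C :: real and \<alpha> :: "real \<Rightarrow> real"
    assume f: "f \<in> Range A" "f \<noteq> 0" and \<delta>\<^sub>0: "0 < \<delta>\<^sub>0" and C: "1 < C"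
      and noise: "\<forall>\<delta>\<in>{0<..<\<delta>\<^sub>0}. norm (g \<delta> - f) \<le> \<delta>"
      and \<alpha>: "\<forall>\<delta>\<in>{0<..<\<delta>\<^sub>0}. 0 < \<alpha> \<delta> \<and> norm (residual (\<alpha> \<delta>) (g \<delta>)) = C * \<delta>"
    show "(\<alpha> \<longlongrightarrow> 0) (at_right 0)"
      by (rule discrepancy_parameter_tendsto_0[OF f C \<delta>\<^sub>0]) (use noise \<alpha> in auto)
    show "((\<lambda>\<delta>. norm (reg (\<alpha> \<delta>) (g \<delta>) - min_norm_solution A f)) \<longlongrightarrow> 0) (at_right 0)"
      by (rule discrepancy_reg_tendsto[OF f C \<delta>\<^sub>0]) (use noise \<alpha> in auto)
  qed
qed

end
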